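(* Let $r\ge 1$, let $n=2r$ or $n=2r+1$, and let $e\in\{1,-1\}$. Let $\mathbf A_q$ denote the modified $q$-Weyl algebra $\mathbf A_q^{\jmath}$ (if $n=2r$) or $\mathbf A_q^{\imath}$ (if $n=2r+1$), and let $N=[\frac{n+1}{2}]$. Let $T_i=T'_{i,e}$ for all $1\le i\le N$, or $T_i=T''_{i,-e}$ for all $1\le i\le N$. Then the following relations hold: $$T_{i-1}T_iT_{i-1}=T_iT_{i-1}T_i\quad\text{if }2\le i\le N-1,$$ $$T_{i-1}T_iT_{i-1}T_i=T_iT_{i-1}T_iT_{i-1}\quad\text{if } i=N,$$ $$T_iT_j=T_jT_i\quad\text{if }|i-j|\ne1,$$ for all indices for which the operators involved are defined.
   Context: Fix an integer $r\ge1$ and let $n=2r$ or $n=2r+1$. Then $N=[\frac{n+1}{2}]$ (integer part) equals $r$ if $n=2r$ and $r+1$ if $n=2r+1$. Put $c_i=1$ for $1\le i\le r$, and $c_{r+1}=2$ if $n=2r$, $c_{r+1}=1$ if $n=2r+1$. The modified $q$-Weyl algebra is the unital associative $\mathbb Q(q)$-algebra generated by $\mathfrak d_i,\mathfrak x_i,\mathfrak m_i^{\pm1}$ ($1\le i\le r+1$) with relations: $\mathfrak m_i\mathfrak m_i^{-1}=\mathfrak m_i^{-1}\mathfrak m_i=1$ and $\mathfrak m_i\mathfrak m_j=\mathfrak m_j\mathfrak m_i$ for all $i,j$; $\mathfrak d_i\mathfrak m_j=\mathfrak m_j\mathfrak d_i$, $\mathfrak x_i\mathfrak m_j=\mathfrak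 m_j\mathfrak x_i$, $\mathfrak d_i\mathfrak x_j=\mathfrak x_j\mathfrak d_i$ for $i\ne j$; $\mathfrak d_i\mathfrak d_j=\mathfrak d_j\mathfrak d_i$, $\mathfrak x_i\mathfrak x_j=\mathfrak x_j\mathfrak x_i$ for all $i,j$; $\mathfrak d_i\mathfrak m_i=q^{c_i}\mathfrak m_i\mathfrak d_i$, $\mathfrak x_i\mathfrak m_i=q^{-c_i}\mathfrak m_i\mathfrak x_i$; $\mathfrak d_i\mathfrak x_i=\dfrac{q^{c_i}\mathfrak m_i-q^{-c_i}\mathfrak m_i^{-1}}{q-q^{-1}}$, $\mathfrak x_i\mathfrak d_i=\dfrac{\mathfrak m_i-\mathfrak m_i^{-1}}{q-q^{-1}}$. It is denoted $\mathbf A_q^{\jmath}$ when $n=2r$ and $\mathbf A_q^{\imath}$ when $n=2r+1$. The operators $T'_{i,e},T''_{i,-e}$ ($1\le i\le N$) are the $\mathbb Q(q)$-algebra automorphisms of this algebra given on generators as follows (generators not listed are fixed). For all $i\le N-1$ (both cases of $n$): $T'_{i,e}$ and $T''_{i,-e}$ both interchange $\mathfrak m_i$ and $\mathfrak m_{i+1}$; $T'_{i,e}(\mathfrak d_{i+1})=-q^{-e}\mathfrak m_{i+1}^{-e}\mathfrak d_i$, $T'_{i,e}(\mathfrak d_i)=\mathfrak m_i^{-e}\mathfrak d_{i+1}$, $T'_{i,e}(\mathfrak x_{i+1})=-q^{e}\mathfrak m_{i+1}^{e}\mathfrak x_i$, $T'_{i,e}(\mathfrak x_i)=\mathfrak m_i^{e}\mathfrak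 x_{i+1}$; $T''_{i,-e}(\mathfrak d_{i+1})=\mathfrak m_{i+1}^{e}\mathfrak d_i$, $T''_{i,-e}(\mathfrak d_i)=-q^{e}\mathfrak m_i^{e}\mathfrak d_{i+1}$, $T''_{i,-e}(\mathfrak x_{i+1})=\mathfrak m_{i+1}^{-e}\mathfrak x_i$, $T''_{i,-e}(\mathfrak x_i)=-q^{-e}\mathfrak m_i^{-e}\mathfrak x_{i+1}$. For $n=2r$, $i=N=r$: all $\mathfrak m_j$ are fixed; $T'_{r,e}(\mathfrak d_{r+1})=q^{e}\mathfrak m_r^{-2e}\mathfrak d_{r+1}$, $T'_{r,e}(\mathfrak d_r)=q^{-2e}\mathfrak m_r^{-e}\mathfrak m_{r+1}^{-e}\mathfrak d_r$, $T'_{r,e}(\mathfrak x_{r+1})=q^{-e}\mathfrak m_r^{2e}\mathfrak x_{r+1}$, $T'_{r,e}(\mathfrak x_r)=q^{e}\mathfrak m_r^{e}\mathfrak m_{r+1}^{e}\mathfrak x_r$; $T''_{r,-e}(\mathfrak d_{r+1})=q^{-e}\mathfrak m_r^{2e}\mathfrak d_{r+1}$, $T''_{r,-e}(\mathfrak d_r)=q^{2e}\mathfrak m_r^{e}\mathfrak m_{r+1}^{e}\mathfrak d_r$, $T''_{r,-e}(\mathfrak x_{r+1})=q^{e}\mathfrak m_r^{-2e}\mathfrak x_{r+1}$, $T''_{r,-e}(\mathfrak x_r)=q^{-e}\mathfrak m_r^{-e}\mathfrak m_{r+1}^{-e}\mathfrak x_r$. For $n=2r+1$, $i=N=r+1$: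 all $\mathfrak m_j$ are fixed; $T'_{r+1,e}(\mathfrak d_{r+1})=\mathfrak m_{r+1}^{-e}\mathfrak d_{r+1}$, $T'_{r+1,e}(\mathfrak x_{r+1})=q^{-e}\mathfrak m_{r+1}^{e}\mathfrak x_{r+1}$; $T''_{r+1,-e}(\mathfrak d_{r+1})=\mathfrak m_{r+1}^{e}\mathfrak d_{r+1}$, $T''_{r+1,-e}(\mathfrak x_{r+1})=q^{e}\mathfrak m_{r+1}^{-e}\mathfrak x_{r+1}$. *)

theory Defs
  imports
    "HOL-Library.Poly_Mapping"
    "HOL-Library.FuncSet"
    "HOL-Computational_Algebra.Fraction_Field"
    "HOL-Computational_Algebra.Polynomial"
    "HOL-Algebra.QuotRing"
begin

type_synonym Qq = "rat poly fract"

definition q :: Qq where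
  "q = Fraction_Field.Fract [:0, 1:] 1"

text \<open>
  The free unital associative algebra on a set of letters is the monoid algebra of the free
  monoid of words. Words are wrapped in a type of their own, since \<^typ>\<open>('a, 'b) poly_mapping\<close>
  takes its product from the additive monoid structure on the exponents.
\<close>

datatype 'a free_monoid = Word (letters: "'a list")

instantiation free_monoid :: (type) monoid_add
begin

definition zero_free_monoid :: "'a free_monoid" where
  "zero_free_monoid = Word []"

definition plus_free_monoid :: "'a free_monoid \<Rightarrow> 'a free_monoid \<Rightarrow> 'a free_monoid" where
  "plus_free_monoid v w = Word (letters v @ letters w)"

instance
  by intro_classes (simp_all add: zero_free_monoid_def plus_free_monoid_def)

end

text \<open>\<open>Mi i\<close> is the generator that becomes the inverse of \<open>M i\<close>.\<close>

datatype gen = D nat | X nat | M nat | Mi nat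

type_synonym free_alg = "gen free_monoid \<Rightarrow>\<^sub>0 Qq"

definition var :: "gen \<Rightarrow> free_alg" where
  "var g = Poly_Mapping.single (Word [g]) 1"

definition const :: "Qq \<Rightarrow> free_alg" where
  "const a = Poly_Mapping.single 0 a"

definition mpow :: "nat \<Rightarrow> int \<Rightarrow> free_alg" where
  "mpow i k = (if k \<ge> 0 then var (M i) ^ nat k else var (Mi i) ^ nat (- k))"

definition gens :: "nat \<Rightarrow> gen set" where
  "gens r = D ` {1..r+1} \<union> X ` {1..r+1} \<union> M ` {1..r+1} \<union> Mi ` {1..r+1}"

definition free_algebra :: "nat \<Rightarrow> free_alg ring" where
  "free_algebra r =
     \<lparr>carrier = {f. \<forall>w \<in> Poly_Mapping.keys f. set (letters w) \<subseteq> gens r},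
      mult = (*), one = 1, zero = 0, add = (+)\<rparr>"

text \<open>
  Below, \<open>n\<close> is \<open>2 * r\<close> or \<open>2 * r + 1\<close>; the two values give the two modified q-Weyl algebras,
  which differ only in the exponent attached to the index \<open>r + 1\<close>.
\<close>

definition c_exp :: "nat \<Rightarrow> nat \<Rightarrow> nat \<Rightarrow> int" where
  "c_exp r n i = (if i = r + 1 \<and> n = 2 * r then 2 else 1)"

inductive weyl_rel :: "nat \<Rightarrow> nat \<Rightarrow> free_alg \<Rightarrow> free_alg \<Rightarrow> bool"
  for r n :: nat where
  m_mi: "i \<in> {1..r+1} \<Longrightarrow> weyl_rel r n (var (M i) * var (Mi i)) 1"
| mi_m: "i \<in> {1..r+1} \<Longrightarrow> weyl_rel r n (var (Mi i) * var (M i)) 1"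
| m_m: "i \<in> {1..r+1} \<Longrightarrow> j \<in> {1..r+1} \<Longrightarrow>
    weyl_rel r n (var (M i) * var (M j)) (var (M j) * var (M i))"
| d_m_comm: "i \<in> {1..r+1} \<Longrightarrow> j \<in> {1..r+1} \<Longrightarrow> i \<noteq> j \<Longrightarrow>
    weyl_rel r n (var (D i) * var (M j)) (var (M j) * var (D i))"
| x_m_comm: "i \<in> {1..r+1} \<Longrightarrow> j \<in> {1..r+1} \<Longrightarrow> i \<noteq> j \<Longrightarrow>
    weyl_rel r n (var (X i) * var (M j)) (var (M j) * var (X i))"
| d_x_comm: "i \<in> {1..r+1} \<Longrightarrow> j \<in> {1..r+1} \<Longrightarrow> i \<noteq> j \<Longrightarrow>
    weyl_rel r n (var (D i) * var (X j)) (var (X j) * var (D i))"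
| d_d: "i \<in> {1..r+1} \<Longrightarrow> j \<in> {1..r+1} \<Longrightarrow>
    weyl_rel r n (var (D i) * var (D j)) (var (D j) * var (D i))"
| x_x: "i \<in> {1..r+1} \<Longrightarrow> j \<in> {1..r+1} \<Longrightarrow>
    weyl_rel r n (var (X i) * var (X j)) (var (X j) * var (X i))"
| d_m: "i \<in> {1..r+1} \<Longrightarrow>
    weyl_rel r n (var (D i) * var (M i)) (const (q powi c_exp r n i) * var (M i) * var (D i))"
| x_m: "i \<in> {1..r+1} \<Longrightarrow>
    weyl_rel r n (var (X i) * var (M i)) (const (q powi (- c_exp r n i)) * var (M i) * var (X i))"
| d_x: "i \<in> {1..r+1} \<Longrightarrow>
    weyl_rel r n (var (D i) * var (X i))
      (const (1 / (q - inverse q)) *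
        (const (q powi c_exp r n i) * var (M i) - const (q powi (- c_exp r n i)) * var (Mi i)))"
| x_d: "i \<in> {1..r+1} \<Longrightarrow>
    weyl_rel r n (var (X i) * var (D i))
      (const (1 / (q - inverse q)) * (var (M i) - var (Mi i)))"

definition weyl_ideal :: "nat \<Rightarrow> nat \<Rightarrow> free_alg set" where
  "weyl_ideal r n = Idl\<^bsub>free_algebra r\<^esub> {a - b |a b. weyl_rel r n a b}"

definition weyl_algebra :: "nat \<Rightarrow> nat \<Rightarrow> free_alg set ring" where
  "weyl_algebra r n = free_algebra r Quot weyl_ideal r n"

definition cls :: "nat \<Rightarrow> nat \<Rightarrow> free_alg \<Rightarrow> free_alg set" where
  "cls r n a = weyl_ideal r n +>\<^bsub>free_algebra r\<^esub> a"

text \<open>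
  Automorphisms as \<open>\<rat>(q)\<close>-algebras. Scalar multiplication by \<open>a\<close> is multiplication by the
  class of \<open>const a\<close>. Restriction to extensional functions makes an automorphism determined
  by its values on the carrier.
\<close>

definition weyl_automorphisms :: "nat \<Rightarrow> nat \<Rightarrow> (free_alg set \<Rightarrow> free_alg set) set" where
  "weyl_automorphisms r n =
     {f \<in> ring_iso (weyl_algebra r n) (weyl_algebra r n) \<inter> extensional (carrier (weyl_algebra r n)).
        \<forall>a. \<forall>u \<in> carrier (weyl_algebra r n).
          f (cls r n (const a) \<otimes>\<^bsub>weyl_algebra r n\<^esub> u) = cls r n (const a) \<otimes>\<^bsub>weyl_algebra r n\<^esub> f u}"

definition aut_of :: "nat \<Rightarrow> nat \<Rightarrow> (gen \<Rightarrow> free_alg) \<Rightarrow> free_alg set \<Rightarrow> free_alg set" where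
  "aut_of r n \<sigma> =
     (THE f. f \<in> weyl_automorphisms r n \<and> (\<forall>g \<in> gens r. f (cls r n (var g)) = cls r n (\<sigma> g)))"

definition num_ops :: "nat \<Rightarrow> nat" where
  "num_ops n = (n + 1) div 2"

definition swap :: "nat \<Rightarrow> nat \<Rightarrow> nat" where
  "swap i j = (if j = i then i + 1 else if j = i + 1 then i else j)"

text \<open>Images of the generators under \<open>T'\<^sub>i\<^sub>,\<^sub>e\<close>.\<close>

fun T1_gen :: "nat \<Rightarrow> nat \<Rightarrow> int \<Rightarrow> nat \<Rightarrow> gen \<Rightarrow> free_alg" where
  "T1_gen r n e i (M j) = (if i < num_ops n then var (M (swap i j)) else var (M j))"
| "T1_gen r n e i (Mi j) = (if i < num_ops n then var (Mi (swap i j)) else var (Mi j))"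
| "T1_gen r n e i (D j) =
    (if i < num_ops n then
       (if j = i + 1 then - const (q powi (- e)) * mpow (i + 1) (- e) * var (D i)
        else if j = i then mpow i (- e) * var (D (i + 1))
        else var (D j))
     else if n = 2 * r then
       (if j = r + 1 then const (q powi e) * mpow r (- 2 * e) * var (D (r + 1))
        else if j = r then const (q powi (- 2 * e)) * mpow r (- e) * mpow (r + 1) (- e) * var (D r)
        else var (D j))
     else
       (if j = r + 1 then mpow (r + 1) (- e) * var (D (r + 1)) else var (D j)))"
| "T1_gen r n e i (X j) =
    (if i < num_ops n then
       (if j = i + 1 then - const (q powi e) * mpow (i + 1) e * var (X i)
        else if j = i then mpow i e * var (X (i + 1))
        else var (X j))
     else if n = 2 * r then
       (if j = r + 1 then const (q powi (- e)) * mpow r (2 * e) * var (X (r + 1))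
        else if j = r then const (q powi e) * mpow r e * mpow (r + 1) e * var (X r)
        else var (X j))
     else
       (if j = r + 1 then const (q powi (- e)) * mpow (r + 1) e * var (X (r + 1)) else var (X j)))"

text \<open>Images of the generators under \<open>T''\<^sub>i\<^sub>,\<^sub>-\<^sub>e\<close>; note the sign of \<open>e\<close> in the subscript.\<close>

fun T2_gen :: "nat \<Rightarrow> nat \<Rightarrow> int \<Rightarrow> nat \<Rightarrow> gen \<Rightarrow> free_alg" where
  "T2_gen r n e i (M j) = (if i < num_ops n then var (M (swap i j)) else var (M j))"
| "T2_gen r n e i (Mi j) = (if i < num_ops n then var (Mi (swap i j)) else var (Mi j))"
| "T2_gen r n e i (D j) =
    (if i < num_ops n then
       (if j = i + 1 then mpow (i + 1) e * var (D i)
        else if j = i then - const (q powi e) * mpow i e * var (D (i + 1))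
        else var (D j))
     else if n = 2 * r then
       (if j = r + 1 then const (q powi (- e)) * mpow r (2 * e) * var (D (r + 1))
        else if j = r then const (q powi (2 * e)) * mpow r e * mpow (r + 1) e * var (D r)
        else var (D j))
     else
       (if j = r + 1 then mpow (r + 1) e * var (D (r + 1)) else var (D j)))"
| "T2_gen r n e i (X j) =
    (if i < num_ops n then
       (if j = i + 1 then mpow (i + 1) (- e) * var (X i)
        else if j = i then - const (q powi (- e)) * mpow i (- e) * var (X (i + 1))
        else var (X j))
     else if n = 2 * r then
       (if j = r + 1 then const (q powi e) * mpow r (- 2 * e) * var (X (r + 1))
        else if j = r then const (q powi (- e)) * mpow r (- e) * mpow (r + 1) (- e) * var (X r)
        else var (X j))
     else
       (if j = r + 1 then const (q powi e) * mpow (r + 1) (- e) * var (X (r + 1)) else var (X j)))"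

definition T1 :: "nat \<Rightarrow> nat \<Rightarrow> int \<Rightarrow> nat \<Rightarrow> free_alg set \<Rightarrow> free_alg set" where
  "T1 r n e i = aut_of r n (T1_gen r n e i)"

definition T2 :: "nat \<Rightarrow> nat \<Rightarrow> int \<Rightarrow> nat \<Rightarrow> free_alg set \<Rightarrow> free_alg set" where
  "T2 r n e i = aut_of r n (T2_gen r n e i)"

end

theory Submission
  imports Defs "HOL-Combinatorics.Permutations"
begin

text \<open>
  All the operators in question are monomial: they permute the \<open>m\<^sub>i\<close> by some permutation \<open>s\<close>, and send
  \<open>d\<^sub>i\<close> and \<open>x\<^sub>i\<close> to \<open>d\<^bsub>s i\<^esub>\<close> and \<open>x\<^bsub>s i\<^esub>\<close> times a scalar and a Laurent monomial in the \<open>m\<^sub>j\<close>. Write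
  \<open>T d\<^sub>i = T(a\<^sub>i \<Prod>\<^sub>j m\<^sub>j\<^bsup>K i j\<^esup>) d\<^bsub>s i\<^esub>\<close>. The relations for \<open>x\<^sub>i d\<^sub>i\<close> and \<open>d\<^sub>i x\<^sub>i\<close> are met by
  \<open>T x\<^sub>i = T(a\<^sub>i\<^bsup>-1\<^esup> q\<^bsup>c i K i i\<^esup> \<Prod>\<^sub>j m\<^sub>j\<^bsup>-K i j\<^esup>) x\<^bsub>s i\<^esub>\<close>, and \<open>T\<close> respects the remaining relations
  as soon as the \<open>a\<^sub>i\<close> are nonzero, \<open>s\<close> preserves the weights \<open>c\<^sub>i\<close> and the
  matrix \<open>c\<^sub>i K j i\<close> is symmetric (\<open>datum_gen_rel\<close>). So \<open>T\<close> is encoded by a datum \<open>(s, a, K)\<close>.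

  Data compose by an explicit law (\<open>subst_mult_datum\<close>): the permutations compose, and, after
  relabelling, the scalars multiply and the matrices add. The data that satisfy these conditions form
  a group under this law, hence they act on the algebra by automorphisms. An automorphism is
  determined by its values on the generators, so each operator is the automorphism of its datum
  (\<open>aut_of_eq_datum_aut\<close>).

  The operators of both families have data of the same shape, with \<open>m\<close>-exponent \<open>f = -e\<close> for \<open>T'\<close>
  and \<open>f = e\<close> for \<open>T''\<close>. The operators with \<open>i < N\<close> correspond to adjacent transpositions. The
  last operator fixes all \<open>m\<^sub>j\<close>, so its datum has the trivial permutation. The
  relations of the theorem thus become identities between permutations, scalars and integer
  matrices supported on the few indices that the operators involve, and these are checked entry by
  entry (\<open>swap_braid\<close>, \<open>swap_even_braid\<close>, \<open>swap_odd_braid\<close> and the commutation lemmas after them).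
\<close>

section \<open>The free algebra and substitution\<close>

lemma const_one [simp]: "const 1 = 1"
  by (simp add: const_def)

lemma single_eq_const_mult_letters:
  "Poly_Mapping.single (Word gs) a = const a * prod_list (map var gs)"
proof (induction gs arbitrary: a)
  case Nil
  show ?case by (simp add: const_def flip: zero_free_monoid_def)
next
  case (Cons g gs)
  have "Poly_Mapping.single (Word (g # gs)) a =
      Poly_Mapping.single (Word [g]) a * Poly_Mapping.single (Word gs) 1"
    by (simp add: mult_single plus_free_monoid_def)
  also have "Poly_Mapping.single (Word [g]) a = const a * var g"
    by (simp add: const_def var_def mult_single plus_free_monoid_def zero_free_monoid_def)
  finally show ?case using Cons[of 1]
    by (simp add: mult.assoc)
qed

lemma poly_mapping_sum_monomials: "(\<Sum>w\<in>Poly_Mapping.keys u. Poly_Mapping.single w (Poly_Mapping.lookup u w)) = u"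
  by (rule poly_mapping_eqI) (simp add: lookup_sum lookup_single when_def in_keys_iff)

lemma const_central: "u * const a = const a * u"
proof -
  have "(\<Sum>w\<in>Poly_Mapping.keys u. Poly_Mapping.single w (Poly_Mapping.lookup u w)) * const a =
      const a * (\<Sum>w\<in>Poly_Mapping.keys u. Poly_Mapping.single w (Poly_Mapping.lookup u w))"
    by (simp add: sum_distrib_left sum_distrib_right const_def mult_single mult.commute)
  then show ?thesis
    by (simp add: poly_mapping_sum_monomials)
qed

lemma const_left_central: "u * (const a * v) = const a * (u * v)"
  by (simp only: const_central[of u] flip: mult.assoc)

lemma const_mult: "const (a * b) = const a * const b"
  by (simp add: const_def mult_single)

lemma const_add: "const (a + b) = const a + const b"
  by (simp add: const_def single_add)

lemma const_uminus: "const (- a) = - const a"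
  by (simp add: const_def single_uminus)

lemma carrier_free_algebra:
  "u \<in> carrier (free_algebra r) \<longleftrightarrow> (\<forall>w \<in> Poly_Mapping.keys u. set (letters w) \<subseteq> gens r)"
  by (simp add: free_algebra_def)

lemma free_algebra_simps [simp]:
  "u \<otimes>\<^bsub>free_algebra r\<^esub> v = u * v" "u \<oplus>\<^bsub>free_algebra r\<^esub> v = u + v"
  "\<one>\<^bsub>free_algebra r\<^esub> = 1" "\<zero>\<^bsub>free_algebra r\<^esub> = 0"
  by (simp_all add: free_algebra_def)

lemma const_closed [simp, intro]: "const a \<in> carrier (free_algebra r)"
  by (auto simp: carrier_free_algebra const_def zero_free_monoid_def)

lemma var_closed [intro]: "g \<in> gens r \<Longrightarrow> var g \<in> carrier (free_algebra r)"
  by (auto simp: carrier_free_algebra var_def)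

lemma free_add_closed [simp, intro]:
  "u \<in> carrier (free_algebra r) \<Longrightarrow> v \<in> carrier (free_algebra r) \<Longrightarrow>
    u + v \<in> carrier (free_algebra r)"
  using keys_add[of u v] by (auto simp: carrier_free_algebra)

lemma free_mult_closed [simp, intro]:
  assumes "u \<in> carrier (free_algebra r)" and "v \<in> carrier (free_algebra r)"
  shows "u * v \<in> carrier (free_algebra r)"
  using keys_mult[of u v] assms
  by (fastforce simp: carrier_free_algebra plus_free_monoid_def)

lemma free_zero_one_closed [simp, intro]:
  "0 \<in> carrier (free_algebra r)" "1 \<in> carrier (free_algebra r)"
  by (auto simp: carrier_free_algebra zero_free_monoid_def)

lemma free_uminus_closed [simp, intro]:
  "u \<in> carrier (free_algebra r) \<Longrightarrow> - u \<in> carrier (free_algebra r)"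
  by (simp add: carrier_free_algebra)

lemma free_diff_closed [simp, intro]:
  "u \<in> carrier (free_algebra r) \<Longrightarrow> v \<in> carrier (free_algebra r) \<Longrightarrow>
    u - v \<in> carrier (free_algebra r)"
  using free_add_closed[of u r "- v"] by simp

lemma free_power_closed [simp, intro]:
  "u \<in> carrier (free_algebra r) \<Longrightarrow> u ^ k \<in> carrier (free_algebra r)"
  by (induction k) auto

lemma free_prod_list_closed:
  "(\<And>x. x \<in> set xs \<Longrightarrow> f x \<in> carrier (free_algebra r)) \<Longrightarrow>
    prod_list (map f xs) \<in> carrier (free_algebra r)"
  by (induction xs) auto

lemma ring_free_algebra: "ring (free_algebra r)"
proof (rule ringI)
  show "abelian_group (free_algebra r)"
  proof (rule abelian_groupI)
    fix u assume "u \<in> carrier (free_algebra r)"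
    then show "\<exists>v\<in>carrier (free_algebra r). v \<oplus>\<^bsub>free_algebra r\<^esub> u = \<zero>\<^bsub>free_algebra r\<^esub>"
      by (intro bexI[of _ "- u"]) auto
  qed (auto simp: algebra_simps)
  show "Group.monoid (free_algebra r)"
    by (rule monoidI) (auto simp: algebra_simps)
qed (auto simp: algebra_simps)

lemma a_minus_free_algebra:
  assumes "u \<in> carrier (free_algebra r)"
  shows "\<ominus>\<^bsub>free_algebra r\<^esub> u = - u"
proof -
  interpret ring "free_algebra r" by (rule ring_free_algebra)
  show ?thesis using assms by (intro minus_equality) auto
qed

text \<open>
  The free algebra is spanned by words, and words are products of letters, so identities between
  algebra homomorphisms need to be tested on scalars and letters only. All comparisons of
  substitutions and of automorphisms below are instances of this principle.
\<close>

lemma free_algebra_induct [consumes 1, case_names const var add mult]: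
  assumes "u \<in> carrier (free_algebra r)"
    and const: "\<And>a. P (const a)"
    and var: "\<And>g. g \<in> gens r \<Longrightarrow> P (var g)"
    and add: "\<And>u v. u \<in> carrier (free_algebra r) \<Longrightarrow> v \<in> carrier (free_algebra r) \<Longrightarrow>
      P u \<Longrightarrow> P v \<Longrightarrow> P (u + v)"
    and mult: "\<And>u v. u \<in> carrier (free_algebra r) \<Longrightarrow> v \<in> carrier (free_algebra r) \<Longrightarrow>
      P u \<Longrightarrow> P v \<Longrightarrow> P (u * v)"
  shows "P u"
proof -
  define Q where "Q v \<longleftrightarrow> v \<in> carrier (free_algebra r) \<and> P v" for v
  have Q_word: "Q (prod_list (map var gs))" if "set gs \<subseteq> gens r" for gs
    using that
  proof (induction gs)
    case Nil
    show ?case using const[of 1] by (simp add: Q_def)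
  next
    case (Cons g gs)
    then show ?case using var[of g] by (auto simp: Q_def intro!: mult)
  qed
  have Q_monomial: "Q (Poly_Mapping.single w a)" if "set (letters w) \<subseteq> gens r" for w a
    using Q_word[OF that] single_eq_const_mult_letters[of "letters w" a] const[of a]
    by (simp add: Q_def mult)
  have "Q (\<Sum>w\<in>S. Poly_Mapping.single w (Poly_Mapping.lookup u w))"
    if "finite S" "\<And>w. w \<in> S \<Longrightarrow> set (letters w) \<subseteq> gens r" for S
    using that
  proof (induction S)
    case empty
    show ?case using const[of 0] by (simp add: Q_def const_def)
  next
    case (insert w S)
    then show ?case using Q_monomial[of w "Poly_Mapping.lookup u w"] by (auto simp: Q_def intro!: add)
  qed
  from this[of "Poly_Mapping.keys u"] assms(1) show ?thesis
    by (simp add: carrier_free_algebra poly_mapping_sum_monomials Q_def)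
qed

text \<open>
  The universal property of the free algebra: \<open>subst \<sigma>\<close> is the algebra endomorphism that extends
  the assignment \<open>\<sigma>\<close> on letters. Letters outside \<^term>\<open>gens r\<close> are substituted as well, which makes
  the homomorphism laws hold without side conditions.
\<close>

definition subst :: "(gen \<Rightarrow> free_alg) \<Rightarrow> free_alg \<Rightarrow> free_alg" where
  "subst \<sigma> u = (\<Sum>w\<in>Poly_Mapping.keys u. const (Poly_Mapping.lookup u w) * prod_list (map \<sigma> (letters w)))"

lemma subst_superset:
  assumes "finite S" and "Poly_Mapping.keys u \<subseteq> S"
  shows "subst \<sigma> u = (\<Sum>w\<in>S. const (Poly_Mapping.lookup u w) * prod_list (map \<sigma> (letters w)))"
  unfolding subst_def
  by (rule sum.mono_neutral_left) (use assms in \<open>auto simp: in_keys_iff const_def\<close>)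

lemma subst_single:
  "subst \<sigma> (Poly_Mapping.single w a) = const a * prod_list (map \<sigma> (letters w))"
  by (subst subst_superset[of "{w}"]) auto

lemma subst_add: "subst \<sigma> (u + v) = subst \<sigma> u + subst \<sigma> v"
proof -
  let ?S = "Poly_Mapping.keys u \<union> Poly_Mapping.keys v"
  show ?thesis
    using keys_add[of u v]
    by (simp add: subst_superset[of ?S] lookup_add const_add distrib_right sum.distrib)
qed

lemma subst_zero [simp]: "subst \<sigma> 0 = 0"
  by (simp add: subst_def)

lemma subst_sum: "subst \<sigma> (sum f S) = (\<Sum>x\<in>S. subst \<sigma> (f x))"
  by (induction S rule: infinite_finite_induct) (simp_all add: subst_add)

lemma subst_mult: "subst \<sigma> (u * v) = subst \<sigma> u * subst \<sigma> v"
proof -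
  let ?sgl = "\<lambda>u w. Poly_Mapping.single w (Poly_Mapping.lookup u w)"
  have "subst \<sigma> (?sgl u w * ?sgl v w') = subst \<sigma> (?sgl u w) * subst \<sigma> (?sgl v w')" for w w'
  proof -
    let ?P = "\<lambda>w. prod_list (map \<sigma> (letters w))"
    have "const a * const b * (p * p') = const a * p * (const b * p')" for a b p p'
    proof -
      have "const a * p * (const b * p') = const a * (p * const b) * p'"
        by (simp only: mult.assoc)
      also have "\<dots> = const a * const b * (p * p')"
        by (simp only: const_central[of p] mult.assoc)
      finally show ?thesis ..
    qed
    then show ?thesis
      by (simp add: mult_single subst_single const_mult plus_free_monoid_def)
  qed
  then have "subst \<sigma> ((\<Sum>w\<in>Poly_Mapping.keys u. ?sgl u w) * (\<Sum>w\<in>Poly_Mapping.keys v. ?sgl v w)) =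
      subst \<sigma> (\<Sum>w\<in>Poly_Mapping.keys u. ?sgl u w) * subst \<sigma> (\<Sum>w\<in>Poly_Mapping.keys v. ?sgl v w)"
    by (simp add: sum_product subst_sum)
  then show ?thesis
    by (simp only: poly_mapping_sum_monomials)
qed

lemma subst_const [simp]: "subst \<sigma> (const a) = const a"
  by (simp add: const_def subst_single zero_free_monoid_def)

lemma subst_one [simp]: "subst \<sigma> 1 = 1"
  using subst_const[of \<sigma> 1] by simp

lemma subst_var [simp]: "subst \<sigma> (var g) = \<sigma> g"
  by (simp add: var_def subst_single)

lemma subst_uminus: "subst \<sigma> (- u) = - subst \<sigma> u"
  using subst_add[of \<sigma> u "- u"] by (simp add: eq_neg_iff_add_eq_0 add.commute)

lemma subst_diff: "subst \<sigma> (u - v) = subst \<sigma> u - subst \<sigma> v"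
  using subst_add[of \<sigma> u "- v"] by (simp add: subst_uminus)

lemma subst_power: "subst \<sigma> (u ^ k) = subst \<sigma> u ^ k"
  by (induction k) (simp_all add: subst_mult)

lemma subst_prod_list: "subst \<sigma> (prod_list us) = prod_list (map (subst \<sigma>) us)"
  by (induction us) (simp_all add: subst_mult)

lemma subst_closed:
  assumes "u \<in> carrier (free_algebra r)"
    and "\<And>g. g \<in> gens r \<Longrightarrow> \<sigma> g \<in> carrier (free_algebra r)"
  shows "subst \<sigma> u \<in> carrier (free_algebra r)"
  using assms(1) by (induction rule: free_algebra_induct) (auto simp: subst_add subst_mult assms)

section \<open>Congruence modulo the defining relations\<close>

locale weyl =
  fixes r n :: nat
begin

abbreviation F :: "free_alg set" where
  "F \<equiv> carrier (free_algebra r)"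

abbreviation idx :: "nat set" where
  "idx \<equiv> {1..r + 1}"

abbreviation c :: "nat \<Rightarrow> int" where
  "c \<equiv> c_exp r n"

text \<open>
  Equality in the quotient, expressed for representatives. Membership of both sides in the free
  algebra is part of the relation, so that chains of congruences carry their own side conditions.
\<close>

definition weyl_cong :: "free_alg \<Rightarrow> free_alg \<Rightarrow> bool" (infix "\<approx>" 50) where
  "u \<approx> v \<longleftrightarrow> u \<in> F \<and> v \<in> F \<and> u - v \<in> weyl_ideal r n"

lemma var_gen_closed [simp]:
  assumes "i \<in> idx"
  shows "var (D i) \<in> F" "var (X i) \<in> F" "var (M i) \<in> F" "var (Mi i) \<in> F"
  using assms by (auto intro!: var_closed simp: gens_def)

lemma mpow_closed [simp]: "i \<in> idx \<Longrightarrow> mpow i k \<in> F"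
  by (simp add: mpow_def)

lemma weyl_rel_closed: "weyl_rel r n u v \<Longrightarrow> u \<in> F \<and> v \<in> F"
  by (induction rule: weyl_rel.induct)
    (intro conjI free_mult_closed free_diff_closed const_closed free_zero_one_closed var_gen_closed;
      assumption)+

lemma ideal_weyl_ideal: "ideal (weyl_ideal r n) (free_algebra r)"
  unfolding weyl_ideal_def
  using weyl_rel_closed by (intro ring.genideal_ideal ring_free_algebra) auto

lemma cong_closed: "u \<approx> v \<Longrightarrow> u \<in> F \<and> v \<in> F"
  by (simp add: weyl_cong_def)

lemma weyl_ideal_add: "u \<in> weyl_ideal r n \<Longrightarrow> v \<in> weyl_ideal r n \<Longrightarrow> u + v \<in> weyl_ideal r n"
  using additive_subgroup.a_closed[OF ideal.axioms(1)[OF ideal_weyl_ideal]] by simp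

lemma weyl_ideal_closed: "u \<in> weyl_ideal r n \<Longrightarrow> u \<in> F"
  using additive_subgroup.a_Hcarr[OF ideal.axioms(1)[OF ideal_weyl_ideal]] by simp

lemma weyl_ideal_uminus: "u \<in> weyl_ideal r n \<Longrightarrow> - u \<in> weyl_ideal r n"
  using additive_subgroup.a_inv_closed[OF ideal.axioms(1)[OF ideal_weyl_ideal]] weyl_ideal_closed
  by (metis a_minus_free_algebra)

lemma weyl_ideal_mult_left: "u \<in> weyl_ideal r n \<Longrightarrow> v \<in> F \<Longrightarrow> v * u \<in> weyl_ideal r n"
  using ideal.I_l_closed[OF ideal_weyl_ideal] by simp

lemma weyl_ideal_mult_right: "u \<in> weyl_ideal r n \<Longrightarrow> v \<in> F \<Longrightarrow> u * v \<in> weyl_ideal r n"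
  using ideal.I_r_closed[OF ideal_weyl_ideal] by simp

lemma weyl_ideal_zero: "0 \<in> weyl_ideal r n"
  using additive_subgroup.zero_closed[OF ideal.axioms(1)[OF ideal_weyl_ideal]] by simp

lemma cong_refl [simp, intro]: "u \<in> F \<Longrightarrow> u \<approx> u"
  by (simp add: weyl_cong_def weyl_ideal_zero)

lemma cong_sym: "u \<approx> v \<Longrightarrow> v \<approx> u"
  using weyl_ideal_uminus[of "u - v"] by (simp add: weyl_cong_def)

lemma cong_trans [trans]: "u \<approx> v \<Longrightarrow> v \<approx> w \<Longrightarrow> u \<approx> w"
  using weyl_ideal_add[of "u - v" "v - w"] by (simp add: weyl_cong_def)

lemma cong_add: "u \<approx> v \<Longrightarrow> u' \<approx> v' \<Longrightarrow> u + u' \<approx> v + v'"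
  using weyl_ideal_add[of "u - v" "u' - v'"] by (simp add: weyl_cong_def algebra_simps)

lemma cong_mult:
  assumes "u \<approx> v" and "u' \<approx> v'"
  shows "u * u' \<approx> v * v'"
proof -
  have "(u - v) * u' + v * (u' - v') \<in> weyl_ideal r n"
    using assms
    by (intro weyl_ideal_add weyl_ideal_mult_left weyl_ideal_mult_right)
      (simp_all add: weyl_cong_def)
  moreover have "(u - v) * u' + v * (u' - v') = u * u' - v * v'"
    by (simp add: algebra_simps)
  ultimately show ?thesis
    using assms by (simp add: weyl_cong_def)
qed

lemma cong_mult_left: "u \<approx> v \<Longrightarrow> w \<in> F \<Longrightarrow> w * u \<approx> w * v"
  by (simp add: cong_mult)

lemma cong_mult_right: "u \<approx> v \<Longrightarrow> w \<in> F \<Longrightarrow> u * w \<approx> v * w"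
  by (simp add: cong_mult)

lemma cong_rel: "weyl_rel r n u v \<Longrightarrow> u \<approx> v"
  using weyl_rel_closed[of u v]
    ring.genideal_self[OF ring_free_algebra, of "{a - b |a b. weyl_rel r n a b}" r] weyl_rel_closed
  by (auto simp: weyl_cong_def weyl_ideal_def)

lemma cls_eq_iff:
  assumes "u \<in> F" and "v \<in> F"
  shows "cls r n u = cls r n v \<longleftrightarrow> u \<approx> v"
proof -
  interpret ring "free_algebra r" by (rule ring_free_algebra)
  have "u \<ominus>\<^bsub>free_algebra r\<^esub> v = u - v"
    using assms by (simp add: a_minus_def a_minus_free_algebra)
  then show ?thesis
    using quotient_eq_iff_same_a_r_cos[OF ideal_weyl_ideal assms] assms
    by (simp add: cls_def weyl_cong_def)
qed

text \<open>
  Every commutation needed below is a commutation up to a power of \<open>q\<close>. Such relations are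
  stable under products and inverses in the second argument, and this reduces the commutation
  with an arbitrary Laurent monomial in the \<open>m\<^sub>j\<close> to the defining relations.
\<close>

definition qcomm :: "Qq \<Rightarrow> free_alg \<Rightarrow> free_alg \<Rightarrow> bool" where
  "qcomm s u v \<longleftrightarrow> u \<in> F \<and> v \<in> F \<and> u * v \<approx> const s * (v * u)"

lemma qcomm_one: "u \<in> F \<Longrightarrow> qcomm 1 u 1"
  by (simp add: qcomm_def)

lemma qcomm_one_left: "u \<in> F \<Longrightarrow> qcomm 1 1 u"
  by (simp add: qcomm_def)

lemma qcomm_sym: "qcomm 1 u v \<Longrightarrow> qcomm 1 v u"
  by (simp add: qcomm_def cong_sym)

lemma qcomm_mult:
  assumes "qcomm s u v" and "qcomm t u w"
  shows "qcomm (s * t) u (v * w)"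
proof -
  have in_F: "u \<in> F" "v \<in> F" "w \<in> F"
    using assms by (auto simp: qcomm_def)
  have "u * (v * w) = (u * v) * w"
    by (simp add: mult.assoc)
  also have "\<dots> \<approx> (const s * (v * u)) * w"
    using assms in_F by (intro cong_mult_left cong_mult_right) (simp_all add: qcomm_def)
  also have "\<dots> = const s * v * (u * w)"
    by (simp add: mult.assoc)
  also have "\<dots> \<approx> const s * v * (const t * (w * u))"
    using assms in_F by (intro cong_mult_left cong_mult_right) (simp_all add: qcomm_def)
  also have "\<dots> = const s * (v * const t) * (w * u)"
    by (simp add: mult.assoc)
  also have "\<dots> = const (s * t) * (v * w * u)"
    by (simp only: const_mult const_central[of v] mult.assoc)
  finally show ?thesis
    using in_F by (simp add: qcomm_def)
qed

lemma qcomm_inverse: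
  assumes "qcomm s u v" and "v * w \<approx> 1" and "w * v \<approx> 1" and "w \<in> F" and "s \<noteq> 0"
  shows "qcomm (inverse s) u w"
proof -
  have in_F: "u \<in> F" "v \<in> F" "w \<in> F"
    using assms by (auto simp: qcomm_def)
  \<comment> \<open>Insert \<open>w * v\<close> on the left, move \<open>u\<close> past this \<open>v\<close>, and cancel \<open>v * w\<close> on the right.\<close>
  have "u * w = 1 * (u * w)" by simp
  also have "\<dots> \<approx> (w * v) * (u * w)"
    using assms in_F by (intro cong_mult_left cong_mult_right cong_sym[OF assms(3)]) simp_all
  also have "\<dots> = const (inverse s * s) * (w * v) * (u * w)"
    using assms(5) by simp
  also have "\<dots> = const (inverse s) * w * (const s * (v * u)) * w"
  proof -
    have "const (inverse s * s) * (w * v) * (u * w) = const (inverse s) * (const s * w) * v * u * w"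
      by (simp only: const_mult mult.assoc)
    also have "const s * w = w * const s"
      by (rule const_central[symmetric])
    finally show ?thesis
      by (simp only: mult.assoc)
  qed
  also have "\<dots> \<approx> const (inverse s) * w * (u * v) * w"
    using assms in_F by (intro cong_mult_left cong_mult_right cong_sym[of "u * v"]) (simp_all add: qcomm_def)
  also have "\<dots> = const (inverse s) * (w * u) * (v * w)"
    by (simp add: mult.assoc)
  also have "\<dots> \<approx> const (inverse s) * (w * u) * 1"
    using assms in_F by (intro cong_mult_left cong_mult_right) simp_all
  finally show ?thesis
    using in_F by (simp add: qcomm_def)
qed

lemma qcomm_power: "qcomm s u v \<Longrightarrow> qcomm (s ^ k) u (v ^ k)"
  by (induction k) (auto simp: qcomm_one qcomm_mult, simp add: qcomm_def)

lemma qcomm_prod_list: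
  assumes "u \<in> F" and "\<And>x. x \<in> set xs \<Longrightarrow> qcomm (s x) u (f x)"
  shows "qcomm (prod_list (map s xs)) u (prod_list (map f xs))"
  using assms(2) by (induction xs) (simp_all add: assms(1) qcomm_one qcomm_mult)

text \<open>
  Both this lemma and the next one are facts about finite products in a commutative monoid. They are
  stated for pairwise commuting families because the ambient ring is not commutative.
\<close>

lemma prod_list_mult_cong:
  assumes "\<And>x. x \<in> set xs \<Longrightarrow> f x \<in> F" and "\<And>x. x \<in> set xs \<Longrightarrow> g x \<in> F"
    and "\<And>x y. x \<in> set xs \<Longrightarrow> y \<in> set xs \<Longrightarrow> qcomm 1 (g x) (f y)"
  shows "prod_list (map f xs) * prod_list (map g xs) \<approx> prod_list (map (\<lambda>x. f x * g x) xs)"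
  using assms
proof (induction xs)
  case (Cons x xs)
  let ?P = "prod_list (map f xs)" and ?Q = "prod_list (map g xs)"
  have in_F: "?P \<in> F" "?Q \<in> F" "f x \<in> F" "g x \<in> F"
    using Cons.prems by (auto intro!: free_prod_list_closed)
  have "qcomm (prod_list (map (\<lambda>_. 1) xs)) (g x) ?P"
    using Cons.prems by (intro qcomm_prod_list) auto
  also have "prod_list (map (\<lambda>_. 1) xs) = (1 :: Qq)"
    by (induction xs) auto
  finally have comm: "?P * g x \<approx> g x * ?P"
    by (simp add: qcomm_def cong_sym)
  have "(f x * ?P) * (g x * ?Q) = f x * (?P * g x) * ?Q"
    by (simp add: mult.assoc)
  also have "\<dots> \<approx> f x * (g x * ?P) * ?Q"
    using in_F comm by (intro cong_mult_left cong_mult_right) simp_all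
  also have "\<dots> = (f x * g x) * (?P * ?Q)"
    by (simp add: mult.assoc)
  also have "\<dots> \<approx> (f x * g x) * prod_list (map (\<lambda>x. f x * g x) xs)"
    using in_F Cons.IH Cons.prems by (intro cong_mult_left free_mult_closed) simp_all
  finally show ?case by simp
qed simp

lemma prod_list_reorder_cong:
  assumes "mset xs = mset ys"
    and "\<And>x y. x \<in> set xs \<Longrightarrow> y \<in> set xs \<Longrightarrow> qcomm 1 (f x) (f y)"
  shows "prod_list (map f xs) \<approx> prod_list (map f ys)"
  using assms
proof (induction xs arbitrary: ys)
  case (Cons x xs)
  from Cons.prems(1) have "x \<in> set ys"
    by (metis list.set_intros(1) set_mset_mset)
  then obtain us vs where ys: "ys = us @ x # vs"
    by (auto simp: in_set_conv_decomp)
  have "set ys = set (x # xs)"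
    using Cons.prems(1) by (metis set_mset_mset)
  then have sets: "set us \<subseteq> set (x # xs)" "set vs \<subseteq> set (x # xs)"
    using ys by auto
  have comm: "qcomm 1 (f y) (f z)" if "y \<in> set (x # xs)" "z \<in> set (x # xs)" for y z
    using Cons.prems(2) that by blast
  then have in_F: "f y \<in> F" if "y \<in> set (x # xs)" for y
    using that by (auto simp: qcomm_def)
  let ?U = "prod_list (map f us)" and ?V = "prod_list (map f vs)"
  have prod_F: "?U \<in> F" "?V \<in> F"
    using in_F sets by (auto intro!: free_prod_list_closed)
  have "qcomm (prod_list (map (\<lambda>_. 1) us)) (f x) ?U"
    using comm sets in_F by (intro qcomm_prod_list) auto
  also have "prod_list (map (\<lambda>_. 1) us) = (1 :: Qq)"
    by (induction us) auto
  finally have U: "f x * ?U \<approx> ?U * f x"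
    by (simp add: qcomm_def)
  have "f x * prod_list (map f xs) \<approx> f x * prod_list (map f (us @ vs))"
    using Cons.prems(1) ys comm in_F by (intro cong_mult_left cong_mult_right Cons.IH) auto
  also have "\<dots> = (f x * ?U) * ?V"
    by (simp add: mult.assoc)
  also have "\<dots> \<approx> (?U * f x) * ?V"
    using U prod_F by (intro cong_mult_left cong_mult_right)
  finally show ?case
    by (simp add: ys mult.assoc)
qed simp

section \<open>Monomials in the invertible generators\<close>

lemma M_Mi_cong: "i \<in> idx \<Longrightarrow> var (M i) * var (Mi i) \<approx> 1"
  by (intro cong_rel weyl_rel.m_mi)

lemma Mi_M_cong: "i \<in> idx \<Longrightarrow> var (Mi i) * var (M i) \<approx> 1"
  by (intro cong_rel weyl_rel.mi_m)

lemma mpow_zero [simp]: "mpow i 0 = 1"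
  by (simp add: mpow_def)

lemma mpow_one: "mpow i 1 = var (M i)"
  by (simp add: mpow_def)

lemma M_mult_mpow:
  assumes "i \<in> idx"
  shows "var (M i) * mpow i k \<approx> mpow i (k + 1)"
proof (cases "k \<ge> 0")
  case True
  then show ?thesis using assms
    by (simp add: mpow_def nat_add_distrib)
next
  case False
  define p where "p = nat (- k - 1)"
  have "nat (- k) = Suc p" "k + 1 = - int p"
    using False by (simp_all add: p_def)
  then have eq: "mpow i k = var (Mi i) * var (Mi i) ^ p" "mpow i (k + 1) = var (Mi i) ^ p"
    using False by (simp_all add: mpow_def)
  have "(var (M i) * var (Mi i)) * var (Mi i) ^ p \<approx> 1 * var (Mi i) ^ p"
    using assms by (intro cong_mult_right M_Mi_cong) simp_all
  then show ?thesis
    by (simp add: eq mult.assoc)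
qed

lemma Mi_mult_mpow:
  assumes "i \<in> idx"
  shows "var (Mi i) * mpow i k \<approx> mpow i (k - 1)"
proof (cases "k \<le> 0")
  case True
  then have "nat (1 - k) = Suc (nat (- k))"
    by simp
  then show ?thesis using assms True
    by (auto simp: mpow_def)
next
  case False
  define p where "p = nat (k - 1)"
  have "nat k = Suc p" "k - 1 = int p"
    using False by (simp_all add: p_def)
  then have eq: "mpow i k = var (M i) * var (M i) ^ p" "mpow i (k - 1) = var (M i) ^ p"
    using False by (simp_all add: mpow_def)
  have "(var (Mi i) * var (M i)) * var (M i) ^ p \<approx> 1 * var (M i) ^ p"
    using assms by (intro cong_mult_right Mi_M_cong) simp_all
  then show ?thesis
    by (simp add: eq mult.assoc)
qed

lemma mpow_add_cong:
  assumes "i \<in> idx"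
  shows "mpow i k * mpow i l \<approx> mpow i (k + l)"
proof -
  have pos: "var (M i) ^ p * mpow i l \<approx> mpow i (int p + l)" for p
  proof (induction p)
    case (Suc p)
    have "var (M i) * (var (M i) ^ p * mpow i l) \<approx> var (M i) * mpow i (int p + l)"
      using assms Suc by (intro cong_mult_left) simp_all
    also have "\<dots> \<approx> mpow i (int p + l + 1)"
      using assms by (rule M_mult_mpow)
    finally show ?case
      by (simp add: mult.assoc algebra_simps)
  qed (use assms in simp)
  have neg: "var (Mi i) ^ p * mpow i l \<approx> mpow i (l - int p)" for p
  proof (induction p)
    case (Suc p)
    have "var (Mi i) * (var (Mi i) ^ p * mpow i l) \<approx> var (Mi i) * mpow i (l - int p)"
      using assms Suc by (intro cong_mult_left) simp_all
    also have "\<dots> \<approx> mpow i (l - int p - 1)"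
      using assms by (rule Mi_mult_mpow)
    finally show ?case
      by (simp add: mult.assoc algebra_simps)
  qed (use assms in simp)
  show ?thesis
    using pos[of "nat k"] neg[of "nat (- k)"] by (cases "k \<ge> 0") (simp_all add: mpow_def add.commute)
qed

lemma qcomm_mpow:
  assumes "qcomm s u (var (M i))" and "i \<in> idx" and "s \<noteq> 0"
  shows "qcomm (s powi k) u (mpow i k)"
proof (cases "k \<ge> 0")
  case True
  then show ?thesis
    using qcomm_power[OF assms(1)] by (simp add: mpow_def power_int_def)
next
  case False
  have "qcomm (inverse s) u (var (Mi i))"
    using assms by (intro qcomm_inverse[OF assms(1)] M_Mi_cong Mi_M_cong) simp_all
  then show ?thesis
    using False qcomm_power[of "inverse s"] by (simp add: mpow_def power_int_def)
qed

lemma mpow_commute: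
  assumes "i \<in> idx" and "j \<in> idx"
  shows "qcomm 1 (mpow i k) (mpow j l)"
proof -
  have "qcomm 1 (var (M i)) (var (M j))"
    using assms cong_rel[OF weyl_rel.m_m] by (simp add: qcomm_def)
  from qcomm_mpow[OF this, of l] have "qcomm 1 (mpow j l) (var (M i))"
    using assms by (simp add: qcomm_sym)
  from qcomm_mpow[OF this, of k] show ?thesis
    using assms by (simp add: qcomm_sym)
qed

text \<open>
  The image of the Laurent monomial \<open>\<Prod>\<^sub>j m\<^sub>j\<^bsup>k j\<^esup>\<close> under the relabelling \<open>s\<close> of the \<open>m\<^sub>j\<close>. Keeping
  the relabelling separate from the exponents makes the action of a monomial substitution a literal
  equality (\<open>subst_mprod\<close> below): only the relabelling changes.
\<close>

definition mprod :: "(nat \<Rightarrow> nat) \<Rightarrow> (nat \<Rightarrow> int) \<Rightarrow> free_alg" where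
  "mprod s k = prod_list (map (\<lambda>j. mpow (s j) (k j)) [1..<r + 2])"

lemma set_idx_list: "set [1..<r + 2] = idx"
  by auto

lemma mprod_closed [simp]: "s permutes idx \<Longrightarrow> mprod s k \<in> F"
  unfolding mprod_def
  by (rule free_prod_list_closed) (simp only: set_idx_list permutes_in_image mpow_closed)

lemma mprod_mult_cong:
  assumes "s permutes idx"
  shows "mprod s k * mprod s l \<approx> mprod s (\<lambda>j. k j + l j)"
proof -
  have s: "s j \<in> idx" if "j \<in> idx" for j
    using assms that by (simp only: permutes_in_image)
  have "mprod s k * mprod s l \<approx> prod_list (map (\<lambda>j. mpow (s j) (k j) * mpow (s j) (l j)) [1..<r + 2])"
    unfolding mprod_def
    by (rule prod_list_mult_cong) (simp_all only: set_idx_list s mpow_closed mpow_commute)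
  also have "\<dots> \<approx> prod_list (map (\<lambda>j. mpow (s j) (k j + l j)) [1..<r + 2])"
  proof -
    have "prod_list (map (\<lambda>j. mpow (s j) (k j) * mpow (s j) (l j)) js) \<approx>
        prod_list (map (\<lambda>j. mpow (s j) (k j + l j)) js)" if "set js \<subseteq> idx" for js
      using that by (induction js) (auto intro!: cong_mult mpow_add_cong s simp del: atLeastAtMost_iff)
    then show ?thesis
      by (simp only: set_idx_list)
  qed
  finally show ?thesis
    by (simp only: mprod_def)
qed

lemma mprod_single:
  assumes "i \<in> idx"
  shows "mprod s (\<lambda>j. if j = i then a else 0) = mpow (s i) a"
proof -
  have "prod_list (map (\<lambda>j. mpow (s j) (if j = i then a else 0)) js) =
      (if i \<in> set js then mpow (s i) a else 1)" if "distinct js" for js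
    using that by (induction js) auto
  then show ?thesis
    unfolding mprod_def by (simp only: distinct_upt set_idx_list assms if_True)
qed

lemma mprod_zero [simp]: "mprod s (\<lambda>_. 0) = 1"
proof -
  have "prod_list (map (\<lambda>_. 1) js) = (1 :: free_alg)" for js :: "nat list"
    by (induction js) auto
  then show ?thesis
    by (simp add: mprod_def)
qed

text \<open>
  The one place where the order of the factors \<open>m\<^sub>j\<close> changes: a relabelling can be moved into the
  exponents.
\<close>

lemma mprod_reindex:
  assumes "s permutes idx" and "p permutes idx"
  shows "mprod s k \<approx> mprod (s \<circ> p) (k \<circ> p)"
proof -
  have s: "s j \<in> idx" if "j \<in> idx" for j
    using assms that by (simp only: permutes_in_image)
  have "mset (map p [1..<r + 2]) = image_mset p (mset_set idx)"
    by (simp only: mset_map flip: mset_set_set[OF distinct_upt] set_idx_list)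
  also have "\<dots> = mset_set idx"
    using assms(2) by (simp only: image_mset_mset_set permutes_inj_on permutes_image)
  also have "\<dots> = mset [1..<r + 2]"
    by (simp only: flip: mset_set_set[OF distinct_upt] set_idx_list)
  finally have "prod_list (map (\<lambda>j. mpow (s j) (k j)) [1..<r + 2]) \<approx>
      prod_list (map (\<lambda>j. mpow (s j) (k j)) (map p [1..<r + 2]))"
    by (intro prod_list_reorder_cong) (simp_all only: set_idx_list s mpow_commute)
  then show ?thesis
    by (simp add: mprod_def o_def)
qed

text \<open>
  If \<open>u\<close> commutes with all but one of the factors, only the exponent of that factor contributes to the
  scalar. This is the situation of \<open>d\<^sub>i\<close> and \<open>x\<^sub>i\<close>.
\<close>

lemma qcomm_mprod:
  assumes "s permutes idx" and "i \<in> idx" and "z \<noteq> 0" and "u \<in> F"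
    and "\<And>j. j \<in> idx \<Longrightarrow> qcomm (if j = i then z else 1) u (var (M (s j)))"
  shows "qcomm (z powi k i) u (mprod s k)"
proof -
  let ?z = "\<lambda>j. if j = i then z powi k i else 1"
  have "qcomm (?z j) u (mpow (s j) (k j))" if "j \<in> idx" for j
  proof -
    have "qcomm ((if j = i then z else 1) powi k j) u (mpow (s j) (k j))"
      using assms(1,3) that
      by (intro qcomm_mpow assms(5)) (simp_all only: permutes_in_image, auto)
    then show ?thesis
      by (simp split: if_splits)
  qed
  then have "qcomm (prod_list (map ?z [1..<r + 2])) u (mprod s k)"
    unfolding mprod_def using assms(4) by (intro qcomm_prod_list) (simp_all only: set_idx_list)
  moreover have "prod_list (map ?z js) = (if i \<in> set js then z powi k i else 1)"
    if "distinct js" for js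
    using that by (induction js) auto
  ultimately show ?thesis
    by (simp only: distinct_upt set_idx_list assms(2) if_True)
qed

lemma q_nonzero [simp]: "q \<noteq> 0"
  by (simp add: q_def Zero_fract_def eq_fract)

lemma qcomm_D_mprod:
  assumes "s permutes idx" and "i \<in> idx"
  shows "qcomm (q powi (c (s i) * k i)) (var (D (s i))) (mprod s k)"
proof -
  have s: "s j \<in> idx" if "j \<in> idx" for j
    using assms that by (simp only: permutes_in_image)
  have "qcomm (if j = i then q powi c (s i) else 1) (var (D (s i))) (var (M (s j)))"
    if "j \<in> idx" for j
  proof (cases "j = i")
    case True
    then show ?thesis
      using weyl_rel.d_m[OF s[OF assms(2)], of n, THEN cong_rel] s[OF assms(2)]
      by (simp add: qcomm_def mult.assoc)
  next
    case False
    then have "s i \<noteq> s j"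
      using assms(1) by (metis permutes_inj injD)
    then show ?thesis
      using weyl_rel.d_m_comm[OF s[OF assms(2)] s[OF that], of n, THEN cong_rel]
        s[OF assms(2)] s[OF that] False
      by (simp add: qcomm_def)
  qed
  from qcomm_mprod[OF assms _ _ this, of k] s[OF assms(2)] show ?thesis
    by (simp add: power_int_mult)
qed

lemma qcomm_X_mprod:
  assumes "s permutes idx" and "i \<in> idx"
  shows "qcomm (q powi (- c (s i) * k i)) (var (X (s i))) (mprod s k)"
proof -
  have s: "s j \<in> idx" if "j \<in> idx" for j
    using assms that by (simp only: permutes_in_image)
  have "qcomm (if j = i then q powi (- c (s i)) else 1) (var (X (s i))) (var (M (s j)))"
    if "j \<in> idx" for j
  proof (cases "j = i")
    case True
    then show ?thesis
      using weyl_rel.x_m[OF s[OF assms(2)], of n, THEN cong_rel] s[OF assms(2)]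
      by (simp add: qcomm_def mult.assoc)
  next
    case False
    then have "s i \<noteq> s j"
      using assms(1) by (metis permutes_inj injD)
    then show ?thesis
      using weyl_rel.x_m_comm[OF s[OF assms(2)] s[OF that], of n, THEN cong_rel]
        s[OF assms(2)] s[OF that] False
      by (simp add: qcomm_def)
  qed
  from qcomm_mprod[OF assms _ _ this, of k] s[OF assms(2)] show ?thesis
    by (simp only: power_int_mult) simp
qed

text \<open>
  Normal form of a product: the Laurent monomials are collected on the left, at the cost of
  the scalar \<open>z\<close> by which \<open>u\<close> commutes past the second one.
\<close>

lemma mprod_var_mult_cong:
  assumes "s permutes idx" and "qcomm z u (mprod s l)" and "v \<in> F"
  shows "(const a * mprod s k * u) * (const b * mprod s l * v) \<approx>
    const (a * b * z) * mprod s (\<lambda>j. k j + l j) * (u * v)"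
proof -
  have in_F: "u \<in> F" "v \<in> F"
    using assms by (auto simp: qcomm_def)
  have "(const a * mprod s k * u) * (const b * mprod s l * v) =
      const a * mprod s k * (u * const b) * mprod s l * v"
    by (simp only: mult.assoc)
  also have "u * const b = const b * u"
    by (rule const_central)
  also have "const a * mprod s k * (const b * u) * mprod s l * v =
      const a * (mprod s k * const b) * (u * mprod s l) * v"
    by (simp only: mult.assoc)
  also have "\<dots> \<approx> const a * (mprod s k * const b) * (const z * (mprod s l * u)) * v"
    using assms in_F by (intro cong_mult_left cong_mult_right) (simp_all add: qcomm_def)
  also have "\<dots> = const (a * b * z) * (mprod s k * mprod s l) * (u * v)"
    by (simp only: const_central[of "mprod s k"] const_left_central[of "mprod s k"] const_mult mult.assoc)
  also have "\<dots> \<approx> const (a * b * z) * mprod s (\<lambda>j. k j + l j) * (u * v)"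
    using assms(1) in_F
    by (intro cong_mult_left cong_mult_right mprod_mult_cong) simp_all
  finally show ?thesis .
qed

end

section \<open>Monomial data and their substitutions\<close>

text \<open>
  A datum \<open>(s, a, K)\<close> describes the algebra endomorphism \<open>T\<close> with \<open>T m\<^sub>i = m\<^bsub>s i\<^esub>\<close> and
  \<open>T d\<^sub>i = T(a\<^sub>i \<Prod>\<^sub>j m\<^sub>j\<^bsup>K i j\<^esup>) d\<^bsub>s i\<^esub>\<close>. The coefficient of \<open>d\<^bsub>s i\<^esub>\<close> is recorded through its preimage
  under \<open>T\<close>. With this normalisation the conditions on \<open>K\<close> do not involve \<open>s\<close>, and
  composition needs no inverse permutation.
\<close>

record monomial_datum =
  perm :: "nat \<Rightarrow> nat"
  scal :: "nat \<Rightarrow> Qq"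
  expo :: "nat \<Rightarrow> nat \<Rightarrow> int"

text \<open>
  The composition law. It is obtained from
  \<open>T\<^sub>A (T\<^sub>B d\<^sub>i) = T\<^sub>A T\<^sub>B(b\<^sub>i \<Prod>\<^sub>j m\<^sub>j\<^bsup>L i j\<^esup>) T\<^sub>A d\<^bsub>t i\<^esub>\<close> for \<open>B = (t, b, L)\<close>, where the monomial
  contributed by \<open>T\<^sub>A d\<^bsub>t i\<^esub>\<close> is pulled back along \<open>T\<^sub>A T\<^sub>B\<close>. So data multiply as in the
  semidirect product of the permutations with the scalars and the matrices.
\<close>

definition datum_mult :: "monomial_datum \<Rightarrow> monomial_datum \<Rightarrow> monomial_datum" (infixl "\<star>" 70) where
  "A \<star> B =
     \<lparr>perm = perm A \<circ> perm B,
      scal = (\<lambda>i. scal B i * scal A (perm B i)),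
      expo = (\<lambda>i j. expo B i j + expo A (perm B i) (perm B j))\<rparr>"

lemma datum_mult_assoc: "A \<star> B \<star> C = A \<star> (B \<star> C)"
  by (simp add: datum_mult_def fun_eq_iff mult.assoc add.assoc)

definition datum_one :: monomial_datum where
  "datum_one = \<lparr>perm = id, scal = (\<lambda>_. 1), expo = (\<lambda>_ _. 0)\<rparr>"

definition datum_inv :: "monomial_datum \<Rightarrow> monomial_datum" where
  "datum_inv A =
     \<lparr>perm = inv_into UNIV (perm A),
      scal = (\<lambda>i. inverse (scal A (inv_into UNIV (perm A) i))),
      expo = (\<lambda>i j. - expo A (inv_into UNIV (perm A) i) (inv_into UNIV (perm A) j))\<rparr>"

context weyl
begin

text \<open>
  The conditions under which a datum preserves the defining relations. The symmetry of \<open>c\<^sub>i K j i\<close>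
  says that the images of \<open>d\<^sub>i\<close> and \<open>d\<^sub>j\<close> commute: interchanging them moves each \<open>d\<close>
  past the Laurent monomial that belongs to the other.
\<close>

definition valid :: "monomial_datum \<Rightarrow> bool" where
  "valid A \<longleftrightarrow> perm A permutes idx \<and> (\<forall>i\<in>idx. c (perm A i) = c i) \<and> (\<forall>i. scal A i \<noteq> 0) \<and>
     (\<forall>i\<in>idx. \<forall>j\<in>idx. c i * expo A j i = c j * expo A i j)"

lemma validI:
  assumes "perm A permutes idx" and "\<And>i. i \<in> idx \<Longrightarrow> c (perm A i) = c i" and "\<And>i. scal A i \<noteq> 0"
    and "\<And>i j. i \<in> idx \<Longrightarrow> j \<in> idx \<Longrightarrow> c i * expo A j i = c j * expo A i j"
  shows "valid A"
  using assms unfolding valid_def by blast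

lemma validD:
  assumes "valid A"
  shows "perm A permutes idx" "i \<in> idx \<Longrightarrow> perm A i \<in> idx" "i \<in> idx \<Longrightarrow> c (perm A i) = c i"
    "scal A i \<noteq> 0" "i \<in> idx \<Longrightarrow> j \<in> idx \<Longrightarrow> c i * expo A j i = c j * expo A i j"
proof -
  show p: "perm A permutes idx" using assms by (simp only: valid_def)
  show "i \<in> idx \<Longrightarrow> perm A i \<in> idx" by (simp only: permutes_in_image[OF p])
qed (use assms in \<open>unfold valid_def, blast+\<close>)

lemma valid_mult: "valid A \<Longrightarrow> valid B \<Longrightarrow> valid (A \<star> B)"
  unfolding valid_def[of "A \<star> B"]
proof (intro conjI ballI allI)
  assume A: "valid A" and B: "valid B"
  show "perm (A \<star> B) permutes idx"
    using permutes_compose[OF validD(1)[OF B] validD(1)[OF A]] by (simp add: datum_mult_def)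
  show "scal (A \<star> B) i \<noteq> 0" for i
    using validD(4)[OF A] validD(4)[OF B] by (simp add: datum_mult_def)
  show "c (perm (A \<star> B) i) = c i" if "i \<in> idx" for i
    using validD(3)[OF A, of "perm B i"] validD(2,3)[OF B that] by (simp add: datum_mult_def)
  show "c i * expo (A \<star> B) j i = c j * expo (A \<star> B) i j" if "i \<in> idx" "j \<in> idx" for i j
    using validD(5)[OF A, of "perm B i" "perm B j"] validD(5)[OF B that]
      validD(2,3)[OF B that(1)] validD(2,3)[OF B that(2)]
    by (simp add: datum_mult_def algebra_simps)
qed

lemma valid_inv:
  assumes "valid A"
  shows "valid (datum_inv A)"
  unfolding valid_def[of "datum_inv A"]
proof (intro conjI ballI allI)
  have p: "inv_into UNIV (perm A) permutes idx"
    using validD(1)[OF assms] by (rule permutes_inv)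
  have in_idx: "inv_into UNIV (perm A) i \<in> idx" if "i \<in> idx" for i
    using that by (simp only: permutes_in_image[OF p])
  have c_inv: "c (inv_into UNIV (perm A) i) = c i" if "i \<in> idx" for i
    using validD(3)[OF assms in_idx[OF that]] permutes_inverses(1)[OF validD(1)[OF assms]] by simp
  show "perm (datum_inv A) permutes idx"
    using p by (simp add: datum_inv_def)
  show "scal (datum_inv A) i \<noteq> 0" for i
    using validD(4)[OF assms] by (simp add: datum_inv_def)
  show "c (perm (datum_inv A) i) = c i" if "i \<in> idx" for i
    using c_inv[OF that] by (simp add: datum_inv_def)
  show "c i * expo (datum_inv A) j i = c j * expo (datum_inv A) i j" if "i \<in> idx" "j \<in> idx" for i j
    using validD(5)[OF assms in_idx[OF that(1)] in_idx[OF that(2)]] c_inv that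
    by (simp add: datum_inv_def)
qed

lemma mult_inv:
  assumes "valid A"
  shows "A \<star> datum_inv A = datum_one" and "datum_inv A \<star> A = datum_one"
  using validD(4)[OF assms] permutes_inverses[OF validD(1)[OF assms]]
    permutes_inv_o[OF validD(1)[OF assms]]
  by (simp_all add: datum_mult_def datum_inv_def datum_one_def)

text \<open>
  The scalar in the image of \<open>x\<^sub>i\<close>. Since \<open>x\<^sub>i d\<^sub>i\<close> is a combination of \<open>m\<^sub>i\<^bsup>\<plusminus>1\<^esup>\<close>, its image has to be
  \<open>x\<^bsub>s i\<^esub> d\<^bsub>s i\<^esub>\<close>. So the scalars and the exponents of the two images cancel, and the power of \<open>q\<close> makes up for moving \<open>x\<^bsub>s i\<^esub>\<close> past the Laurent monomial that belongs to \<open>d\<^sub>i\<close>.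
\<close>

definition xscal :: "monomial_datum \<Rightarrow> nat \<Rightarrow> Qq" where
  "xscal A i = inverse (scal A i) * q powi (c i * expo A i i)"

fun datum_gen :: "monomial_datum \<Rightarrow> gen \<Rightarrow> free_alg" where
  "datum_gen A (M i) = var (M (perm A i))"
| "datum_gen A (Mi i) = var (Mi (perm A i))"
| "datum_gen A (D i) = const (scal A i) * mprod (perm A) (expo A i) * var (D (perm A i))"
| "datum_gen A (X i) = const (xscal A i) * mprod (perm A) (\<lambda>j. - expo A i j) * var (X (perm A i))"

lemma gens_cases:
  assumes "g \<in> gens r"
  obtains (M) i where "i \<in> idx" "g = M i" | (Mi) i where "i \<in> idx" "g = Mi i"
    | (D) i where "i \<in> idx" "g = D i" | (X) i where "i \<in> idx" "g = X i"
  using assms unfolding gens_def by blast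

lemma datum_gen_closed: "valid A \<Longrightarrow> g \<in> gens r \<Longrightarrow> datum_gen A g \<in> F"
  using validD(1,2)[of A]
  by (elim gens_cases; simp only: datum_gen.simps)
    (intro free_mult_closed const_closed mprod_closed var_gen_closed; assumption?; blast)+

lemma subst_datum_gen_closed: "valid A \<Longrightarrow> u \<in> F \<Longrightarrow> subst (datum_gen A) u \<in> F"
  by (intro subst_closed datum_gen_closed)

lemma subst_mpow: "subst (datum_gen A) (mpow i k) = mpow (perm A i) k"
  by (simp add: mpow_def subst_power)

lemma subst_mprod: "subst (datum_gen A) (mprod s k) = mprod (perm A \<circ> s) k"
  unfolding mprod_def subst_prod_list map_map by (simp only: o_def subst_mpow)

text \<open>
  Applied with the two images in the roles of the two factors, this turns a commutation relation
  between generators into a comparison of two powers of \<open>q\<close>.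
\<close>

lemma mprod_var_qcomm:
  assumes "s permutes idx" and "qcomm (w * z) u (mprod s l)" and "qcomm z v (mprod s k)"
    and "u * v \<approx> v * u"
  shows "(const a * mprod s k * u) * (const b * mprod s l * v) \<approx>
    const w * ((const b * mprod s l * v) * (const a * mprod s k * u))"
proof -
  have in_F: "u \<in> F" "v \<in> F"
    using assms by (auto simp: qcomm_def)
  have "(const a * mprod s k * u) * (const b * mprod s l * v) \<approx>
      const (a * b * (w * z)) * mprod s (\<lambda>j. k j + l j) * (u * v)"
    using assms(1,2) in_F(2) by (rule mprod_var_mult_cong)
  also have "\<dots> \<approx> const (a * b * (w * z)) * mprod s (\<lambda>j. k j + l j) * (v * u)"
    using assms(1,4) by (intro cong_mult_left) simp_all
  also have "a * b * (w * z) = w * (b * a * z)"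
    by simp
  also have "const (w * (b * a * z)) * mprod s (\<lambda>j. k j + l j) * (v * u) =
      const w * (const (b * a * z) * mprod s (\<lambda>j. l j + k j) * (v * u))"
    by (simp only: const_mult mult.assoc add.commute)
  also have "\<dots> \<approx> const w * ((const b * mprod s l * v) * (const a * mprod s k * u))"
    using assms(1,3) in_F(1) by (intro cong_mult_left cong_sym[OF mprod_var_mult_cong]) simp_all
  finally show ?thesis .
qed

text \<open>
  This puts \<open>m\<^bsub>s i\<^esub>\<close> into the shape required by \<open>mprod_var_qcomm\<close>, so that the relations
  between \<open>m\<^sub>i\<close> and \<open>d\<^sub>j\<close> or \<open>x\<^sub>j\<close> are covered by the same lemma.
\<close>

lemma var_M_eq_mprod: "i \<in> idx \<Longrightarrow> var (M (s i)) = const 1 * mprod s (\<lambda>j. if j = i then 1 else 0) * 1"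
  by (simp only: mprod_single mpow_one const_one mult_1_left mult_1_right)

lemma datum_gen_rel:
  assumes A: "valid A" and "weyl_rel r n u v"
  shows "subst (datum_gen A) u \<approx> subst (datum_gen A) v"
proof -
  let ?s = "perm A"
  note s = validD(1,2)[OF A]
  note D_mprod = qcomm_D_mprod[OF s(1)] and X_mprod = qcomm_X_mprod[OF s(1)]
  note sym = validD(5)[OF A]
  have one_mprod: "qcomm 1 1 (mprod ?s k)" for k
    by (intro qcomm_one_left mprod_closed s(1))
  have s_inj: "?s i \<noteq> ?s j" if "i \<noteq> j" for i j
    using that s(1) by (metis permutes_inj injD)
  have scal_xscal: "scal A i * xscal A i * q powi (- (c i * expo A i i)) = 1"
    and xscal_scal: "xscal A i * scal A i * q powi (- (c i * expo A i i)) = 1" for i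
    using validD(4)[OF A] by (simp_all add: xscal_def power_int_minus field_simps)
  let ?\<delta> = "\<lambda>i j. if j = i then 1 else 0 :: int"
  show ?thesis
    using assms(2)
  proof cases
    case (m_mi i)
    then show ?thesis using M_Mi_cong[OF s(2)] by (simp add: subst_mult)
  next
    case (mi_m i)
    then show ?thesis using Mi_M_cong[OF s(2)] by (simp add: subst_mult)
  next
    case (m_m i j)
    then show ?thesis using cong_rel[OF weyl_rel.m_m, OF s(2) s(2)] by (simp add: subst_mult)
  next
    case (d_m_comm i j)
    have "datum_gen A (D i) * var (M (?s j)) \<approx> const 1 * (var (M (?s j)) * datum_gen A (D i))"
      unfolding var_M_eq_mprod[OF d_m_comm(4)] datum_gen.simps
      by (rule mprod_var_qcomm[OF s(1) _ one_mprod])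
        (use d_m_comm s D_mprod[of i "?\<delta> j"] in simp_all)
    then show ?thesis using d_m_comm by (simp add: subst_mult)
  next
    case (x_m_comm i j)
    have "datum_gen A (X i) * var (M (?s j)) \<approx> const 1 * (var (M (?s j)) * datum_gen A (X i))"
      unfolding var_M_eq_mprod[OF x_m_comm(4)] datum_gen.simps
      by (rule mprod_var_qcomm[OF s(1) _ one_mprod])
        (use x_m_comm s X_mprod[of i "?\<delta> j"] in simp_all)
    then show ?thesis using x_m_comm by (simp add: subst_mult)
  next
    case (d_m i)
    have "datum_gen A (D i) * var (M (?s i)) \<approx> const (q powi c i) * (var (M (?s i)) * datum_gen A (D i))"
      unfolding var_M_eq_mprod[OF d_m(3)] datum_gen.simps
      by (rule mprod_var_qcomm[OF s(1) _ one_mprod])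
        (use d_m s D_mprod[of i "?\<delta> i"] validD(3)[OF A] in simp_all)
    then show ?thesis using d_m by (simp add: subst_mult mult.assoc)
  next
    case (x_m i)
    have "datum_gen A (X i) * var (M (?s i)) \<approx> const (q powi (- c i)) * (var (M (?s i)) * datum_gen A (X i))"
      unfolding var_M_eq_mprod[OF x_m(3)] datum_gen.simps
      by (rule mprod_var_qcomm[OF s(1) _ one_mprod])
        (use x_m s X_mprod[of i "?\<delta> i"] validD(3)[OF A] in simp_all)
    then show ?thesis using x_m by (simp add: subst_mult mult.assoc)
  next
    case (d_d i j)
    have "datum_gen A (D i) * datum_gen A (D j) \<approx> const 1 * (datum_gen A (D j) * datum_gen A (D i))"
      unfolding datum_gen.simps
    proof (rule mprod_var_qcomm[OF s(1)])
      show "qcomm (q powi (c i * expo A j i)) (var (D (?s j))) (mprod ?s (expo A i))"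
        using D_mprod[OF d_d(4), of "expo A i"] validD(3)[OF A d_d(4)] sym[OF d_d(3,4)] by simp
      show "qcomm (1 * q powi (c i * expo A j i)) (var (D (?s i))) (mprod ?s (expo A j))"
        using D_mprod[OF d_d(3), of "expo A j"] validD(3)[OF A d_d(3)] by simp
      show "var (D (?s i)) * var (D (?s j)) \<approx> var (D (?s j)) * var (D (?s i))"
        using d_d by (intro cong_rel weyl_rel.d_d s(2))
    qed
    then show ?thesis using d_d by (simp add: subst_mult)
  next
    case (x_x i j)
    have "datum_gen A (X i) * datum_gen A (X j) \<approx> const 1 * (datum_gen A (X j) * datum_gen A (X i))"
      unfolding datum_gen.simps
    proof (rule mprod_var_qcomm[OF s(1)])
      show "qcomm (q powi (c i * expo A j i)) (var (X (?s j))) (mprod ?s (\<lambda>k. - expo A i k))"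
        using X_mprod[OF x_x(4), of "\<lambda>k. - expo A i k"] validD(3)[OF A x_x(4)] sym[OF x_x(3,4)]
        by simp
      show "qcomm (1 * q powi (c i * expo A j i)) (var (X (?s i))) (mprod ?s (\<lambda>k. - expo A j k))"
        using X_mprod[OF x_x(3), of "\<lambda>k. - expo A j k"] validD(3)[OF A x_x(3)] by simp
      show "var (X (?s i)) * var (X (?s j)) \<approx> var (X (?s j)) * var (X (?s i))"
        using x_x by (intro cong_rel weyl_rel.x_x s(2))
    qed
    then show ?thesis using x_x by (simp add: subst_mult)
  next
    case (d_x_comm i j)
    have "datum_gen A (D i) * datum_gen A (X j) \<approx> const 1 * (datum_gen A (X j) * datum_gen A (D i))"
      unfolding datum_gen.simps
    proof (rule mprod_var_qcomm[OF s(1)])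
      show "qcomm (q powi (- (c i * expo A j i))) (var (X (?s j))) (mprod ?s (expo A i))"
        using X_mprod[OF d_x_comm(4), of "expo A i"] validD(3)[OF A d_x_comm(4)]
          sym[OF d_x_comm(3,4)] by simp
      show "qcomm (1 * q powi (- (c i * expo A j i))) (var (D (?s i))) (mprod ?s (\<lambda>k. - expo A j k))"
        using D_mprod[OF d_x_comm(3), of "\<lambda>k. - expo A j k"] validD(3)[OF A d_x_comm(3)] by simp
      show "var (D (?s i)) * var (X (?s j)) \<approx> var (X (?s j)) * var (D (?s i))"
        using d_x_comm by (intro cong_rel weyl_rel.d_x_comm s(2) s_inj)
    qed
    then show ?thesis using d_x_comm by (simp add: subst_mult)
  next
    case (d_x i)
    have "qcomm (q powi (- (c i * expo A i i))) (var (D (?s i))) (mprod ?s (\<lambda>k. - expo A i k))"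
      using D_mprod[OF d_x(3), of "\<lambda>k. - expo A i k"] validD(3)[OF A d_x(3)] by simp
    from mprod_var_mult_cong[OF s(1) this, of "var (X (?s i))" "scal A i" "expo A i" "xscal A i"]
    have "datum_gen A (D i) * datum_gen A (X i) \<approx> const 1 * 1 * (var (D (?s i)) * var (X (?s i)))"
      using s(2)[OF d_x(3)]
      by (simp only: scal_xscal add.right_inverse mprod_zero datum_gen.simps var_gen_closed)
    also have "\<dots> = var (D (?s i)) * var (X (?s i))"
      by simp
    also have "\<dots> \<approx> subst (datum_gen A) v"
      using cong_rel[OF weyl_rel.d_x, OF s(2)[OF d_x(3)]] validD(3)[OF A d_x(3)] d_x(2)
      by (simp add: subst_mult subst_diff)
    finally show ?thesis using d_x(1) by (simp add: subst_mult)
  next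
    case (x_d i)
    have "qcomm (q powi (- (c i * expo A i i))) (var (X (?s i))) (mprod ?s (expo A i))"
      using X_mprod[OF x_d(3), of "expo A i"] validD(3)[OF A x_d(3)] by simp
    from mprod_var_mult_cong[OF s(1) this, of "var (D (?s i))" "xscal A i" "\<lambda>k. - expo A i k" "scal A i"]
    have "datum_gen A (X i) * datum_gen A (D i) \<approx> const 1 * 1 * (var (X (?s i)) * var (D (?s i)))"
      using s(2)[OF x_d(3)]
      by (simp only: xscal_scal add.left_inverse mprod_zero datum_gen.simps var_gen_closed)
    also have "\<dots> = var (X (?s i)) * var (D (?s i))"
      by simp
    also have "\<dots> \<approx> subst (datum_gen A) v"
      using cong_rel[OF weyl_rel.x_d, OF s(2)[OF x_d(3)]] x_d(2)
      by (simp add: subst_mult subst_diff)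
    finally show ?thesis using x_d(1) by (simp add: subst_mult)
  qed
qed

text \<open>
  The preimage of the ideal under the substitution is an ideal. It contains the generators
  \<open>a - b\<close> by \<open>datum_gen_rel\<close>, hence the whole ideal, and the substitution descends to the quotient.
\<close>

lemma subst_cong:
  assumes A: "valid A" and "u \<approx> v"
  shows "subst (datum_gen A) u \<approx> subst (datum_gen A) v"
proof -
  let ?K = "{u \<in> F. subst (datum_gen A) u \<in> weyl_ideal r n}"
  interpret R: ring "free_algebra r" by (rule ring_free_algebra)
  have "ring_hom_ring (free_algebra r) (free_algebra r) (subst (datum_gen A))"
    by (rule ring_hom_ringI[OF ring_free_algebra ring_free_algebra])
      (simp_all add: subst_datum_gen_closed[OF A] subst_mult subst_add)
  then have "ideal ?K (free_algebra r)"
    by (rule ring_hom_ring.ideal_vimage[OF _ ideal_weyl_ideal])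
  moreover have "{a - b |a b. weyl_rel r n a b} \<subseteq> ?K"
    using datum_gen_rel[OF A] weyl_rel_closed by (fastforce simp: weyl_cong_def subst_diff)
  ultimately have "weyl_ideal r n \<subseteq> ?K"
    unfolding weyl_ideal_def by (rule R.genideal_minimal[where I = ?K, unfolded weyl_ideal_def])
  then show ?thesis
    using assms by (auto simp: weyl_cong_def subst_diff subst_datum_gen_closed)
qed

lemma subst_datum_gen_mult:
  assumes A: "valid A" and B: "valid B" and "g \<in> gens r"
  shows "subst (datum_gen A) (datum_gen B g) \<approx> datum_gen (A \<star> B) g"
proof -
  let ?s = "perm A \<circ> perm B"
  have s: "?s permutes idx"
    using validD(1)[OF B] validD(1)[OF A] by (rule permutes_compose)
  have product: "const b * mprod ?s k * (const a * mprod (perm A) l * u) \<approx>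
      const (b * a) * mprod ?s (\<lambda>j. k j + l (perm B j)) * u" if "u \<in> F" for a b k l u
  proof -
    have "const b * mprod ?s k * (const a * mprod (perm A) l * u) \<approx>
        const b * mprod ?s k * (const a * mprod ?s (l \<circ> perm B) * u)"
      using that s
      by (intro cong_mult_left cong_mult_right mprod_reindex validD(1)[OF A] validD(1)[OF B]) simp_all
    also have "\<dots> = (const b * mprod ?s k * 1) * (const a * mprod ?s (l \<circ> perm B) * u)"
      by simp
    also have "\<dots> \<approx> const (b * a * 1) * mprod ?s (\<lambda>j. k j + (l \<circ> perm B) j) * (1 * u)"
      using s that by (intro mprod_var_mult_cong qcomm_one_left mprod_closed)
    finally show ?thesis by (simp only: mult_1_left mult_1_right o_def)
  qed
  have F: "datum_gen (A \<star> B) g \<in> F"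
    using assms by (intro datum_gen_closed valid_mult)
  show ?thesis
    using assms(3)
  proof (cases rule: gens_cases)
    case (D i)
    then have "var (D (perm A (perm B i))) \<in> F"
      using validD(2)[OF A] validD(2)[OF B] by (intro var_gen_closed) blast
    from product[OF this] D show ?thesis
      by (simp add: subst_mult subst_mprod datum_mult_def)
  next
    case (X i)
    then have "var (X (perm A (perm B i))) \<in> F"
      using validD(2)[OF A] validD(2)[OF B] by (intro var_gen_closed) blast
    moreover have "xscal B i * xscal A (perm B i) = xscal (A \<star> B) i"
      using validD(3)[OF B X(1)]
      by (simp add: xscal_def datum_mult_def power_int_add distrib_left)
    ultimately show ?thesis
      using X product[of "var (X (perm A (perm B i)))" "xscal B i" "\<lambda>j. - expo B i j"
          "xscal A (perm B i)" "\<lambda>j. - expo A (perm B i) j"]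
      by (simp add: subst_mult subst_mprod datum_mult_def)
  qed (use F in \<open>simp_all add: datum_mult_def\<close>)
qed

lemma subst_mult_datum:
  assumes A: "valid A" and B: "valid B" and "u \<in> F"
  shows "subst (datum_gen A) (subst (datum_gen B) u) \<approx> subst (datum_gen (A \<star> B)) u"
  using assms(3)
proof (induction rule: free_algebra_induct)
  case (var g)
  then show ?case using subst_datum_gen_mult[OF A B] by simp
qed (simp_all add: subst_add subst_mult cong_add cong_mult)

lemma subst_one_datum:
  assumes "u \<in> F"
  shows "subst (datum_gen datum_one) u = u"
  using assms
proof (induction rule: free_algebra_induct)
  case (var g)
  then show ?case
    by (cases rule: gens_cases) (simp_all add: datum_one_def xscal_def)
qed (simp_all add: subst_add subst_mult)

section \<open>Monomial automorphisms of the quotient\<close>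

abbreviation W :: "free_alg set ring" where
  "W \<equiv> weyl_algebra r n"

abbreviation cl :: "free_alg \<Rightarrow> free_alg set" where
  "cl \<equiv> cls r n"

lemma cls_ring_hom: "cl \<in> ring_hom (free_algebra r) W"
  using ideal.rcos_ring_hom[OF ideal_weyl_ideal] unfolding weyl_algebra_def cls_def[abs_def] .

lemma cls_simps [simp]:
  assumes "u \<in> F" and "v \<in> F"
  shows "cl u \<otimes>\<^bsub>W\<^esub> cl v = cl (u * v)" "cl u \<oplus>\<^bsub>W\<^esub> cl v = cl (u + v)"
  using ring_hom_mult[OF cls_ring_hom assms] ring_hom_add[OF cls_ring_hom assms] by simp_all

lemma one_weyl_algebra: "\<one>\<^bsub>W\<^esub> = cl 1"
  using ring_hom_one[OF cls_ring_hom] by simp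

lemma cls_closed [simp]: "u \<in> F \<Longrightarrow> cl u \<in> carrier W"
  using ring_hom_closed[OF cls_ring_hom] .

lemma weyl_algebra_cases:
  assumes "U \<in> carrier W"
  obtains u where "u \<in> F" "U = cl u"
  using assms by (auto simp: weyl_algebra_def FactRing_def A_RCOSETS_def' cls_def)

text \<open>
  The map induced on cosets. The restriction to the carrier makes it the extensional
  representative required of an automorphism.
\<close>

definition datum_aut :: "monomial_datum \<Rightarrow> free_alg set \<Rightarrow> free_alg set" where
  "datum_aut A = restrict (\<lambda>U. cl (subst (datum_gen A) (SOME u. u \<in> F \<and> cl u = U))) (carrier W)"

lemma datum_aut_cls:
  assumes "valid A" and "u \<in> F"
  shows "datum_aut A (cl u) = cl (subst (datum_gen A) u)"
proof -
  let ?v = "SOME v. v \<in> F \<and> cl v = cl u"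
  have v: "?v \<in> F" "cl ?v = cl u"
    using someI[of "\<lambda>v. v \<in> F \<and> cl v = cl u" u] assms(2) by blast+
  then have "subst (datum_gen A) ?v \<approx> subst (datum_gen A) u"
    using assms by (intro subst_cong) (simp_all add: cls_eq_iff)
  then have "cl (subst (datum_gen A) ?v) = cl (subst (datum_gen A) u)"
    by (simp add: cls_eq_iff cong_closed)
  then show ?thesis
    using assms by (simp add: datum_aut_def)
qed

lemma datum_aut_mult:
  assumes "valid A" and "valid B" and "U \<in> carrier W"
  shows "datum_aut A (datum_aut B U) = datum_aut (A \<star> B) U"
proof -
  obtain u where u: "u \<in> F" "U = cl u"
    using assms(3) by (rule weyl_algebra_cases)
  show ?thesis
    using u assms subst_mult_datum[OF assms(1,2) u(1)]
    by (simp add: datum_aut_cls valid_mult subst_datum_gen_closed cls_eq_iff)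
qed

lemma datum_aut_closed: "valid A \<Longrightarrow> U \<in> carrier W \<Longrightarrow> datum_aut A U \<in> carrier W"
  by (erule weyl_algebra_cases) (simp add: datum_aut_cls subst_datum_gen_closed)

lemma datum_aut_one: "valid datum_one \<Longrightarrow> U \<in> carrier W \<Longrightarrow> datum_aut datum_one U = U"
  by (erule weyl_algebra_cases) (simp add: datum_aut_cls subst_one_datum)

text \<open>
  Bijectivity comes from the group structure: the inverse datum induces the inverse map.
\<close>

lemma datum_aut_automorphism:
  assumes A: "valid A"
  shows "datum_aut A \<in> weyl_automorphisms r n"
proof -
  have one: "valid datum_one"
    using valid_mult[OF A valid_inv[OF A]] mult_inv[OF A] by simp
  have "bij_betw (datum_aut A) (carrier W) (carrier W)"
    using A valid_inv[OF A] one
    by (intro bij_betw_byWitness[where f' = "datum_aut (datum_inv A)"])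
      (auto simp: datum_aut_mult mult_inv datum_aut_one datum_aut_closed)
  moreover have "datum_aut A \<in> ring_hom W W"
  proof (rule ring_hom_memI)
    fix U V assume "U \<in> carrier W" and "V \<in> carrier W"
    then obtain u v where uv: "u \<in> F" "U = cl u" "v \<in> F" "V = cl v"
      by (metis weyl_algebra_cases)
    show "datum_aut A (U \<otimes>\<^bsub>W\<^esub> V) = datum_aut A U \<otimes>\<^bsub>W\<^esub> datum_aut A V"
      and "datum_aut A (U \<oplus>\<^bsub>W\<^esub> V) = datum_aut A U \<oplus>\<^bsub>W\<^esub> datum_aut A V"
      using uv A by (simp_all add: datum_aut_cls subst_datum_gen_closed subst_mult subst_add)
  qed (use A in \<open>simp_all add: datum_aut_closed one_weyl_algebra datum_aut_cls\<close>)
  moreover have "datum_aut A (cl (const a) \<otimes>\<^bsub>W\<^esub> U) = cl (const a) \<otimes>\<^bsub>W\<^esub> datum_aut A U"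
    if "U \<in> carrier W" for a U
    using that A
    by (elim weyl_algebra_cases) (simp add: datum_aut_cls subst_datum_gen_closed subst_mult)
  ultimately show ?thesis
    by (simp add: weyl_automorphisms_def ring_iso_def datum_aut_def)
qed

text \<open>
  A linear automorphism is determined by its values on generators. This is the uniqueness
  that the definite description in \<^const>\<open>aut_of\<close> requires.
\<close>

lemma automorphism_eq_subst:
  assumes f: "f \<in> weyl_automorphisms r n"
    and \<sigma>: "\<And>g. g \<in> gens r \<Longrightarrow> \<sigma> g \<in> F" "\<And>g. g \<in> gens r \<Longrightarrow> f (cl (var g)) = cl (\<sigma> g)"
    and "u \<in> F"
  shows "f (cl u) = cl (subst \<sigma> u)"
  using assms(4)
proof (induction rule: free_algebra_induct)
  case (const a)
  have hom: "f \<in> ring_hom W W"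
    and "\<forall>U\<in>carrier W. f (cl (const a) \<otimes>\<^bsub>W\<^esub> U) = cl (const a) \<otimes>\<^bsub>W\<^esub> f U"
    using f by (simp_all add: weyl_automorphisms_def ring_iso_def)
  from this(2) have linear: "f (cl (const a) \<otimes>\<^bsub>W\<^esub> cl 1) = cl (const a) \<otimes>\<^bsub>W\<^esub> f (cl 1)"
    by (simp only: cls_closed free_zero_one_closed)
  from ring_hom_one[OF hom] linear show ?case
    by (simp add: one_weyl_algebra)
next
  case (var g)
  then show ?case using \<sigma> by simp
next
  case (add u v)
  have hom: "f \<in> ring_hom W W"
    using f by (simp add: weyl_automorphisms_def ring_iso_def)
  show ?case
    using ring_hom_add[OF hom, of "cl u" "cl v"] add
    by (simp add: subst_add subst_closed \<sigma>(1))
next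
  case (mult u v)
  have hom: "f \<in> ring_hom W W"
    using f by (simp add: weyl_automorphisms_def ring_iso_def)
  show ?case
    using ring_hom_mult[OF hom, of "cl u" "cl v"] mult
    by (simp add: subst_mult subst_closed \<sigma>(1))
qed

text \<open>
  Existence and uniqueness together identify the automorphism selected by the description operator.
  Congruence on generators is enough, since the description sees only the classes of the \<open>\<sigma> g\<close>.
\<close>

lemma aut_of_eq_datum_aut:
  assumes A: "valid A" and \<sigma>: "\<And>g. g \<in> gens r \<Longrightarrow> \<sigma> g \<approx> datum_gen A g"
  shows "aut_of r n \<sigma> = datum_aut A"
  unfolding aut_of_def
proof (rule the_equality)
  have cls_\<sigma>: "cl (\<sigma> g) = cl (datum_gen A g)" if "g \<in> gens r" for g
    using \<sigma>[OF that] cong_closed[OF \<sigma>[OF that]] by (simp add: cls_eq_iff)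
  show "datum_aut A \<in> weyl_automorphisms r n \<and> (\<forall>g\<in>gens r. datum_aut A (cl (var g)) = cl (\<sigma> g))"
    using A by (simp add: datum_aut_automorphism datum_aut_cls var_closed cls_\<sigma>)
  fix f assume f: "f \<in> weyl_automorphisms r n \<and> (\<forall>g\<in>gens r. f (cl (var g)) = cl (\<sigma> g))"
  have "f (cl u) = datum_aut A (cl u)" if "u \<in> F" for u
    using automorphism_eq_subst[of f "datum_gen A" u] f that
    by (simp add: A datum_gen_closed datum_aut_cls cls_\<sigma>)
  moreover have "f \<in> extensional (carrier W)" and "datum_aut A \<in> extensional (carrier W)"
    using f by (simp_all add: weyl_automorphisms_def datum_aut_def)
  ultimately show "f = datum_aut A"
    by (intro extensionalityI) (auto elim: weyl_algebra_cases)
qed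

end

section \<open>The braid group operators as monomial data\<close>

text \<open>
  The data of the operators. For \<open>i < N\<close>, the coefficient of \<open>d\<^sub>i\<close> in the image of \<open>d\<^bsub>i+1\<^esub>\<close> is
  a scalar times \<open>m\<^bsub>i+1\<^esub>\<^bsup>f\<^esup>\<close>, whose preimage is a scalar times \<open>m\<^sub>i\<^bsup>f\<^esup>\<close>. So the matrix has its entries in the
  off-diagonal positions \<open>(i, i + 1)\<close> and \<open>(i + 1, i)\<close>.
\<close>

definition swap_datum :: "Qq \<Rightarrow> Qq \<Rightarrow> int \<Rightarrow> nat \<Rightarrow> monomial_datum" where
  "swap_datum a b f i =
     \<lparr>perm = swap i,
      scal = (\<lambda>j. if j = i then a else if j = i + 1 then b else 1),
      expo = (\<lambda>j k. if j = i \<and> k = i + 1 \<or> j = i + 1 \<and> k = i then f else 0)\<rparr>"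

definition even_datum :: "Qq \<Rightarrow> Qq \<Rightarrow> int \<Rightarrow> nat \<Rightarrow> monomial_datum" where
  "even_datum a b f r =
     \<lparr>perm = id,
      scal = (\<lambda>j. if j = r then a else if j = r + 1 then b else 1),
      expo = (\<lambda>j k. if j = r \<and> (k = r \<or> k = r + 1) then f else if j = r + 1 \<and> k = r then 2 * f else 0)\<rparr>"

definition odd_datum :: "int \<Rightarrow> nat \<Rightarrow> monomial_datum" where
  "odd_datum f i =
     \<lparr>perm = id, scal = (\<lambda>_. 1), expo = (\<lambda>j k. if j = i \<and> k = i then f else 0)\<rparr>"

lemmas datum_defs = datum_mult_def swap_datum_def even_datum_def odd_datum_def

lemma swap_eq_transpose: "swap i = Transposition.transpose i (i + 1)"
  by (auto simp: fun_eq_iff swap_def transpose_def)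

text \<open>
  In the braid relations of data, each side sends an index to the same place and collects the same
  scalars along the way in a different order. This is why the values of the scalars \<open>a\<close> and \<open>b\<close>
  are arbitrary and both families of operators satisfy the relations.
\<close>

lemma swap_braid:
  "swap_datum a b f i \<star> swap_datum a b f (Suc i) \<star> swap_datum a b f i =
   swap_datum a b f (Suc i) \<star> swap_datum a b f i \<star> swap_datum a b f (Suc i)"
  by (simp add: datum_defs fun_eq_iff swap_def)

lemma swap_even_braid:
  "swap_datum a b f i \<star> even_datum a' b' f (Suc i) \<star> swap_datum a b f i \<star> even_datum a' b' f (Suc i) =
   even_datum a' b' f (Suc i) \<star> swap_datum a b f i \<star> even_datum a' b' f (Suc i) \<star> swap_datum a b f i"
  by (simp add: datum_defs fun_eq_iff swap_def)

lemma swap_odd_braid: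
  "swap_datum a b f i \<star> odd_datum f (Suc i) \<star> swap_datum a b f i \<star> odd_datum f (Suc i) =
   odd_datum f (Suc i) \<star> swap_datum a b f i \<star> odd_datum f (Suc i) \<star> swap_datum a b f i"
  by (simp add: datum_defs fun_eq_iff swap_def)

lemma swap_swap_commute:
  assumes "i + 1 < j"
  shows "swap_datum a b f i \<star> swap_datum a b f j = swap_datum a b f j \<star> swap_datum a b f i"
  using assms by (simp add: datum_defs fun_eq_iff swap_def)

lemma swap_even_commute:
  assumes "i + 1 < j"
  shows "swap_datum a b f i \<star> even_datum a' b' f j = even_datum a' b' f j \<star> swap_datum a b f i"
  using assms by (simp add: datum_defs fun_eq_iff swap_def)

lemma swap_odd_commute:
  assumes "i + 1 < j"
  shows "swap_datum a b f i \<star> odd_datum f j = odd_datum f j \<star> swap_datum a b f i"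
  using assms by (simp add: datum_defs fun_eq_iff swap_def)

text \<open>
  The common form of the data of \<open>T'\<^sub>i\<^sub>,\<^sub>e\<close> and \<open>T''\<^sub>i\<^sub>,\<^sub>-\<^sub>e\<close>. The first has
  \<open>f = -e\<close>, \<open>a = 1\<close>, \<open>b = -q\<^bsup>-e\<^esup>\<close>, the second \<open>f = e\<close>, \<open>a = -q\<^bsup>e\<^esup>\<close>, \<open>b = 1\<close>.
\<close>

definition op_datum :: "nat \<Rightarrow> nat \<Rightarrow> Qq \<Rightarrow> Qq \<Rightarrow> int \<Rightarrow> nat \<Rightarrow> monomial_datum" where
  "op_datum r n a b f i =
     (if i < num_ops n then swap_datum a b f i
      else if n = 2 * r then even_datum (q powi (2 * f)) (q powi (- f)) f r
      else odd_datum f (r + 1))"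

text \<open>
  One table of generator images for both families: they differ only in the sign of the exponents and
  in the scalars attached to the two indices that are interchanged.
\<close>

fun op_gen :: "nat \<Rightarrow> nat \<Rightarrow> Qq \<Rightarrow> Qq \<Rightarrow> int \<Rightarrow> nat \<Rightarrow> gen \<Rightarrow> free_alg" where
  "op_gen r n a b f i (M j) = (if i < num_ops n then var (M (swap i j)) else var (M j))"
| "op_gen r n a b f i (Mi j) = (if i < num_ops n then var (Mi (swap i j)) else var (Mi j))"
| "op_gen r n a b f i (D j) =
    (if i < num_ops n then
       (if j = i + 1 then const b * mpow (i + 1) f * var (D i)
        else if j = i then const a * mpow i f * var (D (i + 1)) else var (D j))
     else if n = 2 * r then
       (if j = r + 1 then const (q powi (- f)) * mpow r (2 * f) * var (D (r + 1))
        else if j = r then const (q powi (2 * f)) * mpow r f * mpow (r + 1) f * var (D r)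
        else var (D j))
     else (if j = r + 1 then mpow (r + 1) f * var (D (r + 1)) else var (D j)))"
| "op_gen r n a b f i (X j) =
    (if i < num_ops n then
       (if j = i + 1 then const (inverse b) * mpow (i + 1) (- f) * var (X i)
        else if j = i then const (inverse a) * mpow i (- f) * var (X (i + 1)) else var (X j))
     else if n = 2 * r then
       (if j = r + 1 then const (q powi f) * mpow r (- 2 * f) * var (X (r + 1))
        else if j = r then const (q powi (- f)) * mpow r (- f) * mpow (r + 1) (- f) * var (X r)
        else var (X j))
     else
       (if j = r + 1 then const (q powi f) * mpow (r + 1) (- f) * var (X (r + 1)) else var (X j)))"

lemma T1_gen_eq_op_gen: "T1_gen r n e i = op_gen r n 1 (- (q powi (- e))) (- e) i"
proof
  show "T1_gen r n e i g = op_gen r n 1 (- (q powi (- e))) (- e) i g" for g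
    by (cases g) (simp_all add: const_uminus power_int_minus)
qed

lemma T2_gen_eq_op_gen: "T2_gen r n e i = op_gen r n (- (q powi e)) 1 e i"
proof
  show "T2_gen r n e i g = op_gen r n (- (q powi e)) 1 e i g" for g
    by (cases g) (simp_all add: const_uminus power_int_minus)
qed

lemma op_datum_braid:
  assumes "Suc i < num_ops n"
  shows "op_datum r n a b f i \<star> (op_datum r n a b f (Suc i) \<star> op_datum r n a b f i) =
    op_datum r n a b f (Suc i) \<star> (op_datum r n a b f i \<star> op_datum r n a b f (Suc i))"
proof -
  have "op_datum r n a b f i = swap_datum a b f i"
    "op_datum r n a b f (Suc i) = swap_datum a b f (Suc i)"
    using assms by (simp_all add: op_datum_def)
  with swap_braid[of a b f i] show ?thesis
    by (simp only: datum_mult_assoc)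
qed

lemma op_datum_braid_last:
  assumes "n = 2 * r \<or> n = 2 * r + 1" and "Suc i = num_ops n"
  shows "op_datum r n a b f i \<star> (op_datum r n a b f (Suc i) \<star> (op_datum r n a b f i \<star> op_datum r n a b f (Suc i))) =
    op_datum r n a b f (Suc i) \<star> (op_datum r n a b f i \<star> (op_datum r n a b f (Suc i) \<star> op_datum r n a b f i))"
  using assms(1)
proof
  assume "n = 2 * r"
  moreover from this assms(2) have "r = Suc i"
    by (simp add: num_ops_def)
  ultimately have "op_datum r n a b f i = swap_datum a b f i"
    "op_datum r n a b f (Suc i) = even_datum (q powi (2 * f)) (q powi (- f)) f (Suc i)"
    using assms(2) by (simp_all add: op_datum_def)
  with swap_even_braid[of a b f i] show ?thesis
    by (simp only: datum_mult_assoc)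
next
  assume "n = 2 * r + 1"
  moreover from this assms(2) have "r = i"
    by (simp add: num_ops_def)
  ultimately have "op_datum r n a b f i = swap_datum a b f i"
    "op_datum r n a b f (Suc i) = odd_datum f (Suc i)"
    using assms(2) by (simp_all add: op_datum_def)
  with swap_odd_braid[of a b f i] show ?thesis
    by (simp only: datum_mult_assoc)
qed

lemma op_datum_commute:
  assumes "n = 2 * r \<or> n = 2 * r + 1" and "i + 1 < j" and "j \<le> num_ops n"
  shows "op_datum r n a b f i \<star> op_datum r n a b f j = op_datum r n a b f j \<star> op_datum r n a b f i"
proof (cases "j < num_ops n")
  case True
  then show ?thesis
    using assms(2) swap_swap_commute[of i j] by (simp add: op_datum_def)
next
  case False
  then have "j = num_ops n"
    using assms(3) by simp
  then have "n = 2 * r \<and> i + 1 < r \<or> n \<noteq> 2 * r \<and> i + 1 < r + 1"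
    using assms(1,2) by (auto simp: num_ops_def)
  then show ?thesis
    using False assms(2,3) swap_even_commute[of i r] swap_odd_commute[of i "r + 1"]
    by (auto simp: op_datum_def)
qed

context weyl
begin

text \<open>
  For even \<open>n\<close> the last operator multiplies \<open>d\<^sub>r\<close> and \<open>x\<^sub>r\<close> by a monomial in two of the \<open>m\<^sub>j\<close>.
\<close>

lemma mprod_pair:
  assumes "s permutes idx" and "i \<in> idx" and "j \<in> idx" and "i \<noteq> j"
  shows "mpow (s i) a * mpow (s j) b \<approx> mprod s (\<lambda>k. if k = i then a else if k = j then b else 0)"
proof -
  have "mprod s (\<lambda>k. if k = i then a else 0) * mprod s (\<lambda>k. if k = j then b else 0) \<approx>
      mprod s (\<lambda>k. (if k = i then a else 0) + (if k = j then b else 0))"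
    using assms(1) by (rule mprod_mult_cong)
  also have "(\<lambda>k. (if k = i then a else 0) + (if k = j then b else 0)) =
      (\<lambda>k. if k = i then a else if k = j then b else 0)"
    using assms(4) by auto
  finally show ?thesis
    by (simp only: mprod_single assms(2,3))
qed

lemma valid_swap_datum:
  assumes "i \<in> idx" and "i + 1 \<in> idx" and "c i = c (i + 1)" and "a \<noteq> 0" and "b \<noteq> 0"
  shows "valid (swap_datum a b f i)"
proof (rule validI)
  show "perm (swap_datum a b f i) permutes idx"
    using permutes_swap_id[OF assms(1,2)] by (simp only: swap_datum_def swap_eq_transpose monomial_datum.simps)
qed (use assms(3-5) in \<open>auto simp: swap_datum_def swap_def\<close>)

text \<open>
  The entries \<open>f\<close> at \<open>(r, r + 1)\<close> and \<open>2 f\<close> at \<open>(r + 1, r)\<close> balance the unequal weights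
  \<open>c\<^sub>r = 1\<close> and \<open>c\<^bsub>r+1\<^esub> = 2\<close>.
\<close>

lemma valid_even_datum:
  assumes "n = 2 * r" and "r \<ge> 1" and "a \<noteq> 0" and "b \<noteq> 0"
  shows "valid (even_datum a b f r)"
proof (rule validI)
  have c: "c r = 1" "c (r + 1) = 2"
    using assms(1) by (simp_all add: c_exp_def)
  show "c i * expo (even_datum a b f r) j i = c j * expo (even_datum a b f r) i j" for i j
    using c by (auto simp: even_datum_def)
qed (use assms(3,4) in \<open>simp_all add: even_datum_def permutes_id\<close>)

lemma valid_odd_datum: "valid (odd_datum f i)"
  by (rule validI) (simp_all add: odd_datum_def permutes_id)

lemma valid_op_datum:
  assumes "r \<ge> 1" and "n = 2 * r \<or> n = 2 * r + 1" and "i \<in> {1..num_ops n}"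
    and "a \<noteq> 0" and "b \<noteq> 0"
  shows "valid (op_datum r n a b f i)"
proof (cases "i < num_ops n")
  case True
  have "i \<in> idx" "i + 1 \<in> idx" "c i = c (i + 1)"
    using True assms(2,3) by (auto simp: num_ops_def c_exp_def)
  then show ?thesis
    using True assms(4,5) valid_swap_datum by (simp add: op_datum_def)
next
  case False
  then show ?thesis
    using assms(1) valid_even_datum valid_odd_datum by (simp add: op_datum_def)
qed

lemma neg_if: "- (if P then x else y) = (if P then - x else - (y :: int))"
  by simp

lemma datum_gen_swap_datum:
  assumes "i \<in> idx" and "i + 1 \<in> idx"
  shows "datum_gen (swap_datum a b f i) (D j) =
      (if j = i + 1 then const b * mpow (i + 1) f * var (D i)
       else if j = i then const a * mpow i f * var (D (i + 1)) else var (D j))"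
    and "datum_gen (swap_datum a b f i) (X j) =
      (if j = i + 1 then const (inverse b) * mpow (i + 1) (- f) * var (X i)
       else if j = i then const (inverse a) * mpow i (- f) * var (X (i + 1)) else var (X j))"
proof -
  have expo: "expo (swap_datum a b f i) (i + 1) = (\<lambda>k. if k = i then f else 0)"
    "expo (swap_datum a b f i) i = (\<lambda>k. if k = i + 1 then f else 0)"
    "j \<noteq> i \<Longrightarrow> j \<noteq> i + 1 \<Longrightarrow> expo (swap_datum a b f i) j = (\<lambda>_. 0)"
    "(\<lambda>k. - expo (swap_datum a b f i) (i + 1) k) = (\<lambda>k. if k = i then - f else 0)"
    "(\<lambda>k. - expo (swap_datum a b f i) i k) = (\<lambda>k. if k = i + 1 then - f else 0)"
    "j \<noteq> i \<Longrightarrow> j \<noteq> i + 1 \<Longrightarrow> (\<lambda>k. - expo (swap_datum a b f i) j k) = (\<lambda>_. 0)"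
    by (auto simp: swap_datum_def fun_eq_iff)
  have scal: "scal (swap_datum a b f i) (i + 1) = b" "scal (swap_datum a b f i) i = a"
    "j \<noteq> i \<Longrightarrow> j \<noteq> i + 1 \<Longrightarrow> scal (swap_datum a b f i) j = 1"
    by (simp_all add: swap_datum_def)
  have xscal: "xscal (swap_datum a b f i) (i + 1) = inverse b"
    "xscal (swap_datum a b f i) i = inverse a"
    "j \<noteq> i \<Longrightarrow> j \<noteq> i + 1 \<Longrightarrow> xscal (swap_datum a b f i) j = 1"
    by (simp_all add: xscal_def swap_datum_def)
  have perm: "perm (swap_datum a b f i) = swap i"
    by (simp add: swap_datum_def)
  have swap: "swap i (i + 1) = i" "swap i i = i + 1" "j \<noteq> i \<Longrightarrow> j \<noteq> i + 1 \<Longrightarrow> swap i j = j"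
    by (simp_all add: swap_def)
  note [simp del] = One_nat_def add_Suc_right
  consider "j = i + 1" | "j = i" | "j \<noteq> i" "j \<noteq> i + 1"
    by blast
  note cases = this
  show "datum_gen (swap_datum a b f i) (D j) =
      (if j = i + 1 then const b * mpow (i + 1) f * var (D i)
       else if j = i then const a * mpow i f * var (D (i + 1)) else var (D j))"
    by (cases rule: cases)
      (simp_all only: datum_gen.simps perm expo scal mprod_single[OF assms(1)] mprod_single[OF assms(2)]
        swap mprod_zero const_one mult_1_left if_True if_False simp_thms refl, simp_all)
  show "datum_gen (swap_datum a b f i) (X j) =
      (if j = i + 1 then const (inverse b) * mpow (i + 1) (- f) * var (X i)
       else if j = i then const (inverse a) * mpow i (- f) * var (X (i + 1)) else var (X j))"
    by (cases rule: cases)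
      (simp_all only: datum_gen.simps perm expo neg_if minus_zero xscal mprod_single[OF assms(1)]
        mprod_single[OF assms(2)] swap mprod_zero const_one mult_1_left if_True if_False simp_thms refl, simp_all)
qed

lemma datum_gen_even_datum:
  assumes "n = 2 * r" and "r \<ge> 1" and "j \<in> idx"
  shows "(if j = r + 1 then const b * mpow r (2 * f) * var (D (r + 1))
       else if j = r then const a * mpow r f * mpow (r + 1) f * var (D r) else var (D j)) \<approx>
      datum_gen (even_datum a b f r) (D j)"
    and "(if j = r + 1 then const (inverse b) * mpow r (- 2 * f) * var (X (r + 1))
       else if j = r then const (inverse a * q powi f) * mpow r (- f) * mpow (r + 1) (- f) * var (X r)
       else var (X j)) \<approx>
      datum_gen (even_datum a b f r) (X j)"
proof -
  have idx: "r \<in> idx" "r + 1 \<in> idx"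
    using assms(2) by simp_all
  have pair: "mpow r f * mpow (r + 1) f \<approx> mprod id (\<lambda>k. if k = r then f else if k = r + 1 then f else 0)" for f
    using mprod_pair[OF permutes_id idx] by simp
  have expo: "expo (even_datum a b f r) (r + 1) = (\<lambda>k. if k = r then 2 * f else 0)"
    "(\<lambda>k. - expo (even_datum a b f r) (r + 1) k) = (\<lambda>k. if k = r then - 2 * f else 0)"
    "expo (even_datum a b f r) r = (\<lambda>k. if k = r then f else if k = r + 1 then f else 0)"
    "(\<lambda>k. - expo (even_datum a b f r) r k) = (\<lambda>k. if k = r then - f else if k = r + 1 then - f else 0)"
    "j \<noteq> r \<Longrightarrow> j \<noteq> r + 1 \<Longrightarrow> expo (even_datum a b f r) j = (\<lambda>_. 0)"
    "j \<noteq> r \<Longrightarrow> j \<noteq> r + 1 \<Longrightarrow> (\<lambda>k. - expo (even_datum a b f r) j k) = (\<lambda>_. 0)"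
    by (auto simp: even_datum_def fun_eq_iff)
  have scal: "scal (even_datum a b f r) (r + 1) = b" "scal (even_datum a b f r) r = a"
    "j \<noteq> r \<Longrightarrow> j \<noteq> r + 1 \<Longrightarrow> scal (even_datum a b f r) j = 1"
    by (simp_all add: even_datum_def)
  have xscal: "xscal (even_datum a b f r) (r + 1) = inverse b"
    "xscal (even_datum a b f r) r = inverse a * q powi f"
    "j \<noteq> r \<Longrightarrow> j \<noteq> r + 1 \<Longrightarrow> xscal (even_datum a b f r) j = 1"
    by (simp_all add: xscal_def even_datum_def c_exp_def)
  have perm: "perm (even_datum a b f r) k = k" "perm (even_datum a b f r) = id" for k
    by (simp_all add: even_datum_def)
  have single: "mprod id (\<lambda>k. if k = r then l else 0) = mpow r l" for l
    using mprod_single[OF idx(1), of id l] by simp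
  have pair_mult: "const a * mpow r f * mpow (r + 1) f * u \<approx>
      const a * mprod id (\<lambda>k. if k = r then f else if k = r + 1 then f else 0) * u"
    if "u \<in> F" for a f u
  proof -
    have "const a * (mpow r f * mpow (r + 1) f) * u \<approx>
        const a * mprod id (\<lambda>k. if k = r then f else if k = r + 1 then f else 0) * u"
      using that by (intro cong_mult_left cong_mult_right pair) simp_all
    then show ?thesis
      by (simp only: mult.assoc)
  qed
  consider (last) "j = r + 1" | (prev) "j = r" | (other) "j \<noteq> r" "j \<noteq> r + 1"
    by blast
  note cases = this
  have ne: "r \<noteq> r + 1"
    by simp
  show "(if j = r + 1 then const b * mpow r (2 * f) * var (D (r + 1))
       else if j = r then const a * mpow r f * mpow (r + 1) f * var (D r) else var (D j)) \<approx>
      datum_gen (even_datum a b f r) (D j)"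
  proof (cases rule: cases)
    case last
    then show ?thesis using idx
      by (simp only: datum_gen.simps if_True simp_thms perm id_apply expo scal single)
        (intro cong_refl free_mult_closed const_closed mpow_closed var_gen_closed)
  next
    case prev
    then show ?thesis using pair_mult[OF var_gen_closed(1)[OF idx(1)]]
      by (simp only: datum_gen.simps if_True if_False simp_thms ne perm id_apply expo scal)
  next
    case other
    then show ?thesis using assms(3)
      by (simp only: datum_gen.simps if_False simp_thms perm id_apply expo scal mprod_zero const_one mult_1_left)
        (intro cong_refl var_gen_closed)
  qed
  show "(if j = r + 1 then const (inverse b) * mpow r (- 2 * f) * var (X (r + 1))
       else if j = r then const (inverse a * q powi f) * mpow r (- f) * mpow (r + 1) (- f) * var (X r)
       else var (X j)) \<approx>
      datum_gen (even_datum a b f r) (X j)"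
  proof (cases rule: cases)
    case last
    then show ?thesis using idx
      by (simp only: datum_gen.simps if_True simp_thms perm id_apply expo neg_if minus_mult_left minus_zero xscal single)
        (intro cong_refl free_mult_closed const_closed mpow_closed var_gen_closed)
  next
    case prev
    then show ?thesis using pair_mult[OF var_gen_closed(2)[OF idx(1)]]
      by (simp only: datum_gen.simps if_True if_False simp_thms ne perm id_apply expo neg_if minus_zero xscal)
  next
    case other
    then show ?thesis using assms(3)
      by (simp only: datum_gen.simps if_False simp_thms perm id_apply expo minus_zero xscal mprod_zero const_one mult_1_left)
        (intro cong_refl var_gen_closed)
  qed
qed

lemma datum_gen_odd_datum:
  assumes "n \<noteq> 2 * r"
  shows "datum_gen (odd_datum f (r + 1)) (D j) =
      (if j = r + 1 then mpow (r + 1) f * var (D (r + 1)) else var (D j))"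
    and "datum_gen (odd_datum f (r + 1)) (X j) =
      (if j = r + 1 then const (q powi f) * mpow (r + 1) (- f) * var (X (r + 1)) else var (X j))"
proof -
  have idx: "r + 1 \<in> idx"
    by simp
  have expo: "expo (odd_datum f (r + 1)) (r + 1) = (\<lambda>k. if k = r + 1 then f else 0)"
    "(\<lambda>k. - expo (odd_datum f (r + 1)) (r + 1) k) = (\<lambda>k. if k = r + 1 then - f else 0)"
    "j \<noteq> r + 1 \<Longrightarrow> expo (odd_datum f (r + 1)) j = (\<lambda>_. 0)"
    by (auto simp: odd_datum_def fun_eq_iff)
  have data: "perm (odd_datum f (r + 1)) = id" "scal (odd_datum f (r + 1)) = (\<lambda>_. 1)"
    by (simp_all add: odd_datum_def)
  have c: "c (r + 1) = 1"
    using assms by (simp add: c_exp_def)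
  show "datum_gen (odd_datum f (r + 1)) (D j) =
      (if j = r + 1 then mpow (r + 1) f * var (D (r + 1)) else var (D j))"
    using mprod_single[OF idx, of id f] by (cases "j = r + 1") (simp_all add: data expo del: One_nat_def add_Suc_right)
  show "datum_gen (odd_datum f (r + 1)) (X j) =
      (if j = r + 1 then const (q powi f) * mpow (r + 1) (- f) * var (X (r + 1)) else var (X j))"
  proof (cases "j = r + 1")
    case True
    have "xscal (odd_datum f (r + 1)) (r + 1) = q powi f"
      using c by (simp add: xscal_def odd_datum_def)
    then show ?thesis
      by (simp only: True datum_gen.simps expo neg_if minus_zero data mprod_single[OF idx] id_apply simp_thms if_True)
  qed (simp add: odd_datum_def xscal_def)
qed

lemma op_gen_cong_datum_gen:
  assumes rn: "r \<ge> 1" "n = 2 * r \<or> n = 2 * r + 1" and i: "i \<in> {1..num_ops n}" and g: "g \<in> gens r"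
    and ab: "a \<noteq> 0" "b \<noteq> 0"
  shows "op_gen r n a b f i g \<approx> datum_gen (op_datum r n a b f i) g"
proof -
  have F: "datum_gen (op_datum r n a b f i) g \<in> F"
    using rn i ab g by (intro datum_gen_closed valid_op_datum)
  show ?thesis
  proof (cases "i < num_ops n")
    case True
    then have idx: "i \<in> idx" "i + 1 \<in> idx"
      using rn(2) i by (auto simp: num_ops_def)
    have datum: "op_datum r n a b f i = swap_datum a b f i"
      using True by (simp add: op_datum_def)
    have "op_gen r n a b f i g = datum_gen (swap_datum a b f i) g"
    proof (cases g)
      case (D j)
      then show ?thesis by (simp only: op_gen.simps True if_True datum_gen_swap_datum[OF idx])
    next
      case (X j)
      then show ?thesis by (simp only: op_gen.simps True if_True datum_gen_swap_datum[OF idx])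
    qed (simp_all add: True swap_datum_def)
    then show ?thesis
      using F by (simp add: datum)
  next
    case last: False
    show ?thesis
    proof (cases "n = 2 * r")
      case True
      have datum: "op_datum r n a b f i = even_datum (q powi (2 * f)) (q powi (- f)) f r"
        using True last by (simp add: op_datum_def)
      have "q powi (2 * f) = q powi f * q powi f"
        unfolding mult_2 by (rule power_int_add) simp
      then have powers: "inverse (q powi (2 * f)) * q powi f = q powi (- f)"
        "inverse (q powi (- f)) = q powi f"
        by (simp_all only: power_int_minus inverse_mult_distrib inverse_inverse_eq mult.assoc
            left_inverse power_int_eq_0_iff q_nonzero simp_thms mult_1_right)
      show ?thesis
      proof (cases g)
        case (D j)
        then have "j \<in> idx"
          using g by (auto simp: gens_def)
        from datum_gen_even_datum(1)[OF True rn(1) this] D show ?thesis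
          by (simp only: datum op_gen.simps last True[THEN eqTrueI] if_True if_False)
      next
        case (X j)
        then have "j \<in> idx"
          using g by (auto simp: gens_def)
        from datum_gen_even_datum(2)[OF True rn(1) this, where f = f and a = "q powi (2 * f)" and b = "q powi (- f)"] X
        show ?thesis
          by (simp only: datum op_gen.simps last True[THEN eqTrueI] if_True if_False powers)
      qed (use F in \<open>simp_all add: datum last even_datum_def\<close>)
    next
      case False
      have datum: "op_datum r n a b f i = odd_datum f (r + 1)"
        using False last by (simp add: op_datum_def)
      have "op_gen r n a b f i g = datum_gen (odd_datum f (r + 1)) g"
      proof (cases g)
        case (D j)
        then show ?thesis by (simp only: op_gen.simps last False if_False datum_gen_odd_datum[OF False])
      next
        case (X j)
        then show ?thesis by (simp only: op_gen.simps last False if_False datum_gen_odd_datum[OF False])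
      qed (simp_all add: last odd_datum_def)
      then show ?thesis
        using F by (simp add: datum)
    qed
  qed
qed

text \<open>
  Since composites of data automorphisms are again data automorphisms, each relation between
  operators is the image of the corresponding identity between data.
\<close>

lemma braid_relations:
  assumes rn: "r \<ge> 1" "n = 2 * r \<or> n = 2 * r + 1" and ab: "a \<noteq> 0" "b \<noteq> 0"
    and T: "\<And>i. i \<in> {1..num_ops n} \<Longrightarrow> T i = datum_aut (op_datum r n a b f i)"
  shows "2 \<le> i \<Longrightarrow> i \<le> num_ops n - 1 \<Longrightarrow> u \<in> carrier W \<Longrightarrow>
      T (i - 1) (T i (T (i - 1) u)) = T i (T (i - 1) (T i u))"
    and "2 \<le> i \<Longrightarrow> i = num_ops n \<Longrightarrow> u \<in> carrier W \<Longrightarrow>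
      T (i - 1) (T i (T (i - 1) (T i u))) = T i (T (i - 1) (T i (T (i - 1) u)))"
    and "i \<in> {1..num_ops n} \<Longrightarrow> j \<in> {1..num_ops n} \<Longrightarrow> \<bar>int i - int j\<bar> \<noteq> 1 \<Longrightarrow>
      u \<in> carrier W \<Longrightarrow> T i (T j u) = T j (T i u)"
proof -
  let ?A = "op_datum r n a b f"
  have A: "valid (?A i)" if "i \<in> {1..num_ops n}" for i
    using rn that ab by (rule valid_op_datum)
  show "T (i - 1) (T i (T (i - 1) u)) = T i (T (i - 1) (T i u))"
    if i: "2 \<le> i" "i \<le> num_ops n - 1" and u: "u \<in> carrier W" for i u
  proof -
    obtain k where k: "i = Suc k" "k \<in> {1..num_ops n}" "Suc k \<in> {1..num_ops n}" "Suc k < num_ops n"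
      using i by (cases i) auto
    show ?thesis
      using op_datum_braid[OF k(4)] k(1) u A[OF k(2)] A[OF k(3)] T[OF k(2)] T[OF k(3)]
      by (simp add: datum_aut_mult datum_aut_closed valid_mult)
  qed
  show "T (i - 1) (T i (T (i - 1) (T i u))) = T i (T (i - 1) (T i (T (i - 1) u)))"
    if i: "2 \<le> i" "i = num_ops n" and u: "u \<in> carrier W" for i u
  proof -
    obtain k where k: "i = Suc k" "k \<in> {1..num_ops n}" "Suc k \<in> {1..num_ops n}" "Suc k = num_ops n"
      using i by (cases i) auto
    show ?thesis
      using op_datum_braid_last[OF rn(2) k(4)] k(1) u A[OF k(2)] A[OF k(3)] T[OF k(2)] T[OF k(3)]
      by (simp add: datum_aut_mult datum_aut_closed valid_mult)
  qed
  show "T i (T j u) = T j (T i u)"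
    if ij: "i \<in> {1..num_ops n}" "j \<in> {1..num_ops n}" "\<bar>int i - int j\<bar> \<noteq> 1"
      and u: "u \<in> carrier W" for i j u
  proof -
    have "i = j \<or> i + 1 < j \<or> j + 1 < i"
      using ij(3) by linarith
    then have "?A i \<star> ?A j = ?A j \<star> ?A i"
      using op_datum_commute[OF rn(2)] ij(1,2) by (metis atLeastAtMost_iff)
    then show ?thesis
      using u A[OF ij(1)] A[OF ij(2)] T[OF ij(1)] T[OF ij(2)] by (simp add: datum_aut_mult)
  qed
qed

end

theorem theorem3p6:
  fixes r n :: nat and e :: int and T :: "nat \<Rightarrow> free_alg set \<Rightarrow> free_alg set"
  assumes "r \<ge> 1"
    and "n = 2 * r \<or> n = 2 * r + 1"
    and "e \<in> {1, -1}"
    and "(\<forall>i \<in> {1..num_ops n}. T i = T1 r n e i) \<or> (\<forall>i \<in> {1..num_ops n}. T i = T2 r n e i)"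
  shows "(\<forall>i. 2 \<le> i \<and> i \<le> num_ops n - 1 \<longrightarrow>
            (\<forall>u \<in> carrier (weyl_algebra r n).
               T (i - 1) (T i (T (i - 1) u)) = T i (T (i - 1) (T i u)))) \<and>
         (\<forall>i. 2 \<le> i \<and> i = num_ops n \<longrightarrow>
            (\<forall>u \<in> carrier (weyl_algebra r n).
               T (i - 1) (T i (T (i - 1) (T i u))) = T i (T (i - 1) (T i (T (i - 1) u))))) \<and>
         (\<forall>i \<in> {1..num_ops n}. \<forall>j \<in> {1..num_ops n}. \<bar>int i - int j\<bar> \<noteq> 1 \<longrightarrow>
            (\<forall>u \<in> carrier (weyl_algebra r n). T i (T j u) = T j (T i u)))"
proof -
  interpret weyl r n .
  obtain a b f where "a \<noteq> 0" and "b \<noteq> 0"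
    and "\<And>i. i \<in> {1..num_ops n} \<Longrightarrow> T i = datum_aut (op_datum r n a b f i)"
    using assms(4)
  proof
    assume "\<forall>i\<in>{1..num_ops n}. T i = T1 r n e i"
    then have "T i = datum_aut (op_datum r n 1 (- (q powi (- e))) (- e) i)"
      if "i \<in> {1..num_ops n}" for i
      using that assms(1,2) aut_of_eq_datum_aut[OF valid_op_datum op_gen_cong_datum_gen]
      by (simp add: T1_def T1_gen_eq_op_gen)
    then show thesis
      by (intro that[of 1 "- (q powi (- e))" "- e"]) simp_all
  next
    assume "\<forall>i\<in>{1..num_ops n}. T i = T2 r n e i"
    then have "T i = datum_aut (op_datum r n (- (q powi e)) 1 e i)"
      if "i \<in> {1..num_ops n}" for i
      using that assms(1,2) aut_of_eq_datum_aut[OF valid_op_datum op_gen_cong_datum_gen]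
      by (simp add: T2_def T2_gen_eq_op_gen)
    then show thesis
      by (intro that[of "- (q powi e)" 1 e]) simp_all
  qed
  from braid_relations[OF assms(1,2) this] show ?thesis
    by blast
qed

end
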